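(* Let $d\ge1$, let $\ell_1,\ldots,\ell_d>0$ be dimension-wise length-scales, and let $\alpha_1=\cdots=\alpha_d=1/\sqrt2$. Suppose that the nodes $x_{i,1},\ldots,x_{i,N_i}\in\mathbb{R}$ and weights $w_1^i,\ldots,w_{N_i}^i\in\mathbb{R}$ of the one-dimensional $N_i$-point quadrature rules $Q_{i,N_i}(f)=\sum_{n=1}^{N_i}w_n^i f(x_{i,n})$, $i=1,\ldots,d$, satisfy 1. $\sup_{1\le i\le d}\sum_{n=1}^{N_i}|w_n^i|\le W_{\mathcal{N}}$ for some $W_{\mathcal{N}}\ge1$; 2. $Q_{i,N_i}(\varphi_{i,n})=\mu(\varphi_{i,n})$ for each $n=0,\ldots,M_{N_i}-1$ and $i=1,\ldots,d$, for some $M_{N_i}\ge1$; 3. $\sup_{1\le n\le N_i}|x_{i,n}|\le2\sqrt{M_{N_i}}/\beta_i$ for each $i=1,\ldots,d$. Define the tensor product rule $Q_{\mathcal{N}}^d=Q_{1,N_1}\otimes\cdots\otimes Q_{d,N_d}$, where $\mathcal{N}=(N_1,\ldots,N_d)$. Then there exist constants $C>0$, independent of $\mathcal{N}$ and $Q_{\mathcal{N}}^d$, and $0<\eta<1$ such that $$e(Q_{\mathcal{N}}^d)\le C\,W_{\mathcal{N}}^d\,\eta^M,\qquad M=\min(M_{N_1},\ldots,M_{N_d}).$$ Explicit forms of the constants, written for the case in which $\beta_i=\beta$, $\tau_i=\tau$ and $\lambda_i=\lambda$ do not depend on $i$, are $$C=2d\Big(\frac{K\sqrt{\tau\beta}}{1-\sqrt\lambda\,e^{1/\beta^2}}\Big)^d,\qquad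 \eta=\sqrt\lambda\,e^{1/\beta^2}<1,\qquad K=1.087.$$
   Context: $\mu$ is the standard Gaussian measure on $\mathbb{R}$, $\mu^d$ the standard Gaussian measure on $\mathbb{R}^d$, and $\mu(f)=\int f\,\mathrm{d}\mu$, $\mu^d(f)=\int f\,\mathrm{d}\mu^d$. The kernel on $\mathbb{R}^d$ is the separable Gaussian kernel $k^d(x,y)=\prod_{i=1}^d k_i(x_i,y_i)$ with $k_i(x_i,y_i)=\exp(-(x_i-y_i)^2/(2\ell_i^2))$, and $\mathcal{H}^d$ is its reproducing kernel Hilbert space of functions on $\mathbb{R}^d$. The worst-case error of a cubature rule $Q$ on $\mathbb{R}^d$ is $e(Q)=\sup_{\|f\|_{\mathcal{H}^d}\le1}|\mu^d(f)-Q(f)|$. The tensor product rule is $$(Q_{1,N_1}\otimes\cdots\otimes Q_{d,N_d})(f)=\sum_{\mathcal{I}:\,1\le\mathcal{I}(i)\le N_i}\Big(\prod_{i=1}^dw_{\mathcal{I}(i)}^i\Big)f(x_{1,\mathcal{I}(1)},\ldots,x_{d,\mathcal{I}(d)}).$$ $\mathrm{H}_n(x)=(-1)^ne^{x^2/2}\frac{\mathrm{d}^n}{\mathrm{d}x^n}e^{-x^2/2}$ are the probabilists' Hermite polynomials. For $i=1,\ldots,d$, with $\alpha_i=1/\sqrt2$, set $$\epsilon_i=\frac1{\sqrt2\,\ell_i},\qquad \beta_i=\Big(1+\Big(\frac{2\epsilon_i}{\alpha_i}\Big)^2\Big)^{1/4},\qquad \delta_i^2=\frac{\alpha_i^2}{2}(\beta_i^2-1),$$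 $$\tau_i=\sqrt{\frac{1/2}{1/2+\delta_i^2+\epsilon_i^2}},\qquad \lambda_i=\frac{\epsilon_i^2}{1/2+\delta_i^2+\epsilon_i^2},\qquad \varphi_{i,n}(x)=\sqrt{\frac{\beta_i}{n!}}\,e^{-\delta_i^2x^2}\mathrm{H}_n(\sqrt2\,\alpha_i\beta_i x)\quad(n\ge0).$$ For each $i$, the $\varphi_{i,n}$ are the $L^2(\mu)$-orthonormal Mercer eigenfunctions, with eigenvalues $\tau_i\lambda_i^n$, of the one-dimensional Gaussian kernel $k_i$. *)

theory Defs
  imports "HOL-Probability.Probability"
begin

text \<open>
  A real Hilbert space of functions is given by its carrier \<open>H\<close> and its inner product \<open>ip\<close>
  (relevant only on \<open>H\<close>).  For a given kernel there is at most one such pair, up to the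
  values of \<open>ip\<close> outside \<open>H\<close>.
\<close>

locale rkhs =
  fixes k :: "'a \<Rightarrow> 'a \<Rightarrow> real"
    and H :: "('a \<Rightarrow> real) set"
    and ip :: "('a \<Rightarrow> real) \<Rightarrow> ('a \<Rightarrow> real) \<Rightarrow> real"
  assumes zero_mem: "(\<lambda>x. 0) \<in> H"
    and add_mem: "\<lbrakk>f \<in> H; g \<in> H\<rbrakk> \<Longrightarrow> (\<lambda>x. f x + g x) \<in> H"
    and scale_mem: "f \<in> H \<Longrightarrow> (\<lambda>x. c * f x) \<in> H"
    and ip_commute: "\<lbrakk>f \<in> H; g \<in> H\<rbrakk> \<Longrightarrow> ip f g = ip g f"
    and ip_add: "\<lbrakk>f \<in> H; g \<in> H; h \<in> H\<rbrakk> \<Longrightarrow> ip (\<lambda>x. f x + g x) h = ip f h + ip g h"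
    and ip_scale: "\<lbrakk>f \<in> H; g \<in> H\<rbrakk> \<Longrightarrow> ip (\<lambda>x. c * f x) g = c * ip f g"
    and ip_nonneg: "f \<in> H \<Longrightarrow> ip f f \<ge> 0"
    and ip_definite: "\<lbrakk>f \<in> H; ip f f = 0\<rbrakk> \<Longrightarrow> f = (\<lambda>x. 0)"
    and complete: "\<lbrakk>\<And>n. F n \<in> H;
        \<forall>e>0. \<exists>m. \<forall>i\<ge>m. \<forall>j\<ge>m. sqrt (ip (\<lambda>x. F i x - F j x) (\<lambda>x. F i x - F j x)) < e\<rbrakk>
      \<Longrightarrow> \<exists>f\<in>H. (\<lambda>n::nat. sqrt (ip (\<lambda>x. F n x - f x) (\<lambda>x. F n x - f x))) \<longlonglongrightarrow> 0"
    and kernel_mem: "(\<lambda>y. k y x) \<in> H"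
    and reproducing: "f \<in> H \<Longrightarrow> ip f (\<lambda>y. k y x) = f x"

definition gauss_kernel1 :: "real \<Rightarrow> real \<Rightarrow> real \<Rightarrow> real" where
  "gauss_kernel1 l x y = exp (- (x - y)\<^sup>2 / (2 * l\<^sup>2))"

definition gauss_kernel :: "('d::finite \<Rightarrow> real) \<Rightarrow> real ^ 'd \<Rightarrow> real ^ 'd \<Rightarrow> real" where
  "gauss_kernel l x y = (\<Prod>i\<in>UNIV. gauss_kernel1 (l i) (x $ i) (y $ i))"

definition std_gaussian :: "(real ^ 'd::finite) measure" where
  "std_gaussian = density lborel (\<lambda>x. ennreal (\<Prod>i\<in>UNIV. std_normal_density (x $ i)))"

text \<open>The supremum is taken in \<open>ereal\<close>, so that no boundedness is presupposed.\<close>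

definition worst_case_error ::
  "(real ^ 'd::finite \<Rightarrow> real) set \<Rightarrow> ((real ^ 'd \<Rightarrow> real) \<Rightarrow> (real ^ 'd \<Rightarrow> real) \<Rightarrow> real)
    \<Rightarrow> ((real ^ 'd \<Rightarrow> real) \<Rightarrow> real) \<Rightarrow> ereal" where
  "worst_case_error H ip Q =
    (SUP f\<in>{f \<in> H. sqrt (ip f f) \<le> 1}. ereal \<bar>(\<integral>x. f x \<partial>std_gaussian) - Q f\<bar>)"

definition quadrature :: "nat \<Rightarrow> (nat \<Rightarrow> real) \<Rightarrow> (nat \<Rightarrow> real) \<Rightarrow> (real \<Rightarrow> real) \<Rightarrow> real" where
  "quadrature N x w f = (\<Sum>n=1..N. w n * f (x n))"

definition tensor_rule ::
  "('d::finite \<Rightarrow> nat) \<Rightarrow> ('d \<Rightarrow> nat \<Rightarrow> real) \<Rightarrow> ('d \<Rightarrow> nat \<Rightarrow> real) \<Rightarrow> (real ^ 'd \<Rightarrow> real) \<Rightarrow> real" where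
  "tensor_rule N x w f =
    (\<Sum>I\<in>{I. \<forall>i. 1 \<le> I i \<and> I i \<le> N i}. (\<Prod>i\<in>UNIV. w i (I i)) * f (\<chi> i. x i (I i)))"

definition hermite :: "nat \<Rightarrow> real \<Rightarrow> real" where
  "hermite n x = (-1) ^ n * exp (x\<^sup>2 / 2) * (deriv ^^ n) (\<lambda>t. exp (- t\<^sup>2 / 2)) x"

text \<open>Parameters of the Mercer expansion, as functions of the length-scale \<open>l\<close>.\<close>

definition mercer_alpha :: real where
  "mercer_alpha = 1 / sqrt 2"

definition mercer_eps :: "real \<Rightarrow> real" where
  "mercer_eps l = 1 / (sqrt 2 * l)"

definition mercer_beta :: "real \<Rightarrow> real" where
  "mercer_beta l = (1 + (2 * mercer_eps l / mercer_alpha)\<^sup>2) powr (1/4)"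

definition mercer_delta_sq :: "real \<Rightarrow> real" where
  "mercer_delta_sq l = mercer_alpha\<^sup>2 / 2 * ((mercer_beta l)\<^sup>2 - 1)"

definition mercer_tau :: "real \<Rightarrow> real" where
  "mercer_tau l = sqrt ((1/2) / (1/2 + mercer_delta_sq l + (mercer_eps l)\<^sup>2))"

definition mercer_lambda :: "real \<Rightarrow> real" where
  "mercer_lambda l = (mercer_eps l)\<^sup>2 / (1/2 + mercer_delta_sq l + (mercer_eps l)\<^sup>2)"

definition mercer_phi :: "real \<Rightarrow> nat \<Rightarrow> real \<Rightarrow> real" where
  "mercer_phi l n x = sqrt (mercer_beta l / fact n) * exp (- mercer_delta_sq l * x\<^sup>2)
    * hermite n (sqrt 2 * mercer_alpha * mercer_beta l * x)"

end

theory Submission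
  imports Defs "HOL-Complex_Analysis.Cauchy_Integral_Formula"
begin

text \<open>
  For \<open>f\<close> in the unit ball, positive definiteness gives \<open>(\<mu> f - Q f)\<^sup>2 \<le> A - 2 B + D\<close>, where \<open>A\<close>, \<open>B\<close> and \<open>D\<close>
  are the double integrals of the kernel against \<open>\<mu> \<otimes> \<mu>\<close>, \<open>\<mu> \<otimes> Q\<close> and \<open>Q \<otimes> Q\<close>.  For product measures
  and tensor product rules these are products of their one-dimensional counterparts, so telescoping
  \<open>\<mu>\<^sub>1 \<otimes> \<dots> \<otimes> \<mu>\<^sub>d - Q\<^sub>1 \<otimes> \<dots> \<otimes> Q\<^sub>d\<close> bounds the error by
  \<open>d W^(d - 1)\<close> times the largest one-dimensional error.

  In one dimension \<open>A - 2 B + D = (\<Sum>n. \<tau> \<lambda>^n (\<mu> \<phi>\<^sub>n - Q \<phi>\<^sub>n)\<^sup>2)\<close> by the Mercer expansion, which is Mehler's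
  formula, and exactness removes the terms \<open>n < M\<close>.  In the others, \<open>\<mu> \<phi>\<^sub>n\<close> is at most \<open>\<lambda>^(n/2)\<close> by Stein's
  identity, and \<open>Q \<phi>\<^sub>n\<close> is controlled by a Cramer type bound for Hermite functions on
  \<open>\<bar>x\<bar> \<le> 2 sqrt M / \<beta>\<close>.  Keeping the squares when summing over \<open>n\<close>, instead of estimating a sum of absolute
  values, gains enough to replace the constant 1.087 of Cramer's inequality by the more elementary 2.16.
\<close>

subsection \<open>Hermite polynomials\<close>

text \<open>The space \<open>H\<close> is abstract: no element of it representing the Gaussian
  integral is given, and its members are not assumed to be measurable. Measurability comes from
  continuity of the kernel. In place of the representer stands the function
  \<open>ip (r x) (r y) - e x * e y\<close>, where \<open>r x\<close> represents the functional g(x)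
  - Q g and \<open>e x\<close> is f(x) - Q f. It is positive semidefinite for f in the unit ball,
  and its double integral is A - 2 B + D minus the squared error. The numerical margin is thin:
  comparing the one-dimensional bound with the required constant comes down to 2.16 \<le> 2 * 1.087.
  Telescoping yields the one-dimensional constant only to the first power; its d-th power in C is
  reached because 1.087 sqrt(\<tau> \<beta>) / (1 - \<eta>) \<ge> 1.\<close>

fun herm :: "nat \<Rightarrow> 'a::real_normed_field \<Rightarrow> 'a" where
  "herm 0 x = 1"
| "herm (Suc 0) x = x"
| "herm (Suc (Suc n)) x = x * herm (Suc n) x - of_nat (Suc n) * herm n x"

text \<open>\<open>herm\<close> lives over any real normed field because it is needed twice: over
  the reals in the eigenfunctions, and over the complex numbers, where Cauchy's formula produces it.
  This is the bridge.\<close>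

lemma herm_of_real: "herm n (of_real x) = (of_real (herm n x) :: 'a::real_normed_field)"
  by (induction n x rule: herm.induct) auto

lemma herm_minus: "herm n (- x) = (-1) ^ n * herm n x"
  by (induction n x rule: herm.induct) (auto simp: algebra_simps)

text \<open>The Appell property. At n = 0 the truncated index \<open>n - 1\<close> is harmless, the
  factor \<open>of_nat n\<close> being 0.\<close>

lemma DERIV_herm: "(herm n has_field_derivative of_nat n * herm (n - 1) x) (at x within S)"
proof (induction n x rule: herm.induct)
  case (1 x)
  have "herm 0 = (\<lambda>x. 1 :: 'a)" by (auto simp: fun_eq_iff)
  then show ?case by simp
next
  case (2 x)
  have "herm (Suc 0) = (\<lambda>x. x :: 'a)" by (auto simp: fun_eq_iff)
  then show ?case by simp
next
  case (3 n x)
  have *: "herm (Suc (Suc n)) = (\<lambda>x. x * herm (Suc n) x - of_nat (Suc n) * herm n x :: 'a)"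
    by (auto simp: fun_eq_iff)
  have "((\<lambda>x. x * herm (Suc n) x - of_nat (Suc n) * herm n x) has_field_derivative
      (1 * herm (Suc n) x + (of_nat (Suc n) * herm n x) * x
        - of_nat (Suc n) * (of_nat n * herm (n - 1) x))) (at x within S)"
    using 3 by (auto intro!: derivative_eq_intros)
  moreover have "1 * herm (Suc n) x + (of_nat (Suc n) * herm n x) * x
        - of_nat (Suc n) * (of_nat n * herm (n - 1) x) = of_nat (Suc (Suc n)) * herm (Suc n) x"
    by (cases n) (auto simp: algebra_simps)
  ultimately show ?case unfolding * by simp
qed

lemma continuous_on_herm [continuous_intros]:
  "continuous_on S f \<Longrightarrow> continuous_on S (\<lambda>x. herm n (f x))"
  by (rule continuous_on_compose2[of UNIV "herm n" S f])
     (auto intro: DERIV_continuous_on DERIV_herm)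

lemma borel_measurable_herm [measurable]: "herm n \<in> borel_measurable (borel :: real measure)"
  by (intro borel_measurable_continuous_onI continuous_intros)

text \<open>The hypothesis is the differential equation of exp (c z - z^2 / 2). With c = 0 it yields
  the Rodrigues formula, with c = y the Taylor coefficients of the generating function of the
  Hermite polynomials.\<close>

lemma higher_deriv_gauss:
  fixes f :: "'a::real_normed_field \<Rightarrow> 'a"
  assumes "\<And>z. (f has_field_derivative (c - z) * f z) (at z)"
  shows "(deriv ^^ n) f z = herm n (c - z) * f z"
proof (induction n arbitrary: z)
  case (Suc n)
  have "((\<lambda>z. herm n (c - z) * f z) has_field_derivative
      (of_nat n * herm (n - 1) (c - z) * (0 - 1)) * f z + ((c - z) * f z) * herm n (c - z)) (at z)"
    by (intro DERIV_mult DERIV_chain2[OF DERIV_herm] derivative_intros assms)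
  then have "deriv (\<lambda>z. herm n (c - z) * f z) z = 
      (of_nat n * herm (n - 1) (c - z) * (0 - 1)) * f z + ((c - z) * f z) * herm n (c - z)"
    by (rule DERIV_imp_deriv)
  also have "\<dots> = herm (Suc n) (c - z) * f z"
    by (cases n) (auto simp: algebra_simps)
  finally show ?case by (simp add: Suc.IH[abs_def])
qed auto

lemma hermite_eq: "hermite n x = herm n x"
proof -
  have "(deriv ^^ n) (\<lambda>t. exp (- t\<^sup>2 / 2)) x = herm n (0 - x) * exp (- x\<^sup>2 / 2)"
    by (rule higher_deriv_gauss) (auto intro!: derivative_eq_intros)
  then have "hermite n x = (-1) ^ n * exp (x\<^sup>2 / 2) * ((-1) ^ n * herm n x * exp (- x\<^sup>2 / 2))"
    by (simp only: hermite_def herm_minus diff_0)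
  also have "\<dots> = (-1) ^ n * (-1) ^ n * herm n x * (exp (x\<^sup>2 / 2) * exp (- x\<^sup>2 / 2))"
    by (simp only: mult_ac)
  also have "exp (x\<^sup>2 / 2) * exp (- x\<^sup>2 / 2) = 1" by (simp flip: exp_add)
  finally show ?thesis by (simp flip: power_mult_distrib)
qed

text \<open>For t < 1 this is t < artanh t. It serves two unrelated purposes: at t = 1/(2n + 1) it
  drives the induction for the factorial bound, and at t = 1/\<beta>^2 it gives \<eta> < 1. The
  difference of the two sides decreases because 1 - 2x < exp(-2x).\<close>

lemma exp_double_less:
  fixes t :: real
  assumes "0 < t"
  shows "(1 - t) * exp (2 * t) < 1 + t"
proof -
  define g where "g = (\<lambda>t::real. (1 - t) * exp (2 * t) - (1 + t))"
  define g' where "g' = (\<lambda>t::real. (1 - 2 * t) * exp (2 * t) - 1)"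
  have d: "(g has_real_derivative g' x) (at x)" for x
    unfolding g_def g'_def by (auto intro!: derivative_eq_intros simp: algebra_simps)
  have "g' x < 0" if "x > 0" for x
  proof -
    have "exp (- (2 * x)) > 1 + - (2 * x)" using that exp_minus_greater[of "2 * x"] by simp
    then have "(1 - 2 * x) * exp (2 * x) < exp (- (2 * x)) * exp (2 * x)"
      by (intro mult_strict_right_mono) auto
    also have "\<dots> = 1" by (simp flip: exp_add)
    finally show ?thesis by (simp add: g'_def)
  qed
  then have "g t < g 0" using d
    by (intro DERIV_neg_imp_decreasing_open[OF assms] exI[of _ "g' _"] conjI)
      (auto simp: g_def intro!: continuous_intros)
  then show ?thesis by (simp add: g_def)
qed

text \<open>The step from n to n + 1 needs e \<le> (1 + 1/n)^(n + 1/2). The choice t = 1/(2n + 1)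
  makes (1 + t)/(1 - t) = (n + 1)/n, and the power 2n + 1 keeps exponents integral. Equality at n =
  1 is the origin of the constant e.\<close>

lemma fact_le_stirling:
  assumes "n > 0"
  shows "(fact n :: real) \<le> exp 1 * sqrt (real n) * real n ^ n * exp (- real n)"
  using assms
proof (induction n rule: nat_induct_non_zero)
  case 1
  then show ?case by (simp flip: exp_add)
next
  case (Suc n)
  define r s :: real where "r = real n" and "s = real (Suc n)"
  define t where "t = 1 / (2 * r + 1)"
  have rs: "r > 0" "s = r + 1" using Suc by (auto simp: r_def s_def)
  have t: "t > 0" "1 - t = 2 * t * r" "1 + t = 2 * t * s" using rs by (auto simp: t_def field_simps)
  have "2 * t * (r * exp (2 * t)) \<le> 2 * t * s"
    using exp_double_less[OF t(1)] unfolding t(2,3) by (simp add: mult.assoc)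
  then have "r * exp (2 * t) \<le> s" using t(1) by (subst (asm) mult_le_cancel_left_pos) auto
  then have "(r * exp (2 * t)) ^ (2 * n + 1) \<le> s ^ (2 * n + 1)"
    using rs by (intro power_mono) auto
  moreover have "exp (2 * t) ^ (2 * n + 1) = exp 1 * exp 1"
  proof -
    have "exp (2 * t) ^ (2 * n + 1) = exp (real (2 * n + 1) * (2 * t))"
      by (rule exp_of_nat_mult[symmetric])
    also have "real (2 * n + 1) * (2 * t) = 1 + 1" using rs by (simp add: t_def r_def divide_eq_eq)
    finally show ?thesis unfolding exp_add .
  qed
  ultimately have *: "r ^ (2 * n + 1) * (exp 1 * exp 1) \<le> s ^ (2 * n + 1)"
    unfolding power_mult_distrib by simp
  have sq: "(sqrt x * x ^ n)\<^sup>2 = x ^ (2 * n + 1)" if "x \<ge> 0" for x :: real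
    using that by (simp add: power_mult_distrib power_mult[symmetric] mult.commute[of n])
  have "(sqrt r * r ^ n * exp 1)\<^sup>2 \<le> (sqrt s * s ^ n)\<^sup>2"
    unfolding power_mult_distrib[of _ "exp 1"] using * rs by (simp only: sq power2_eq_square[of "exp 1"])
  then have "sqrt r * r ^ n * exp 1 \<le> sqrt s * s ^ n"
    by (rule power2_le_imp_le) (use rs in auto)
  then have "exp (- s) * (sqrt r * r ^ n * exp 1) \<le> exp (- s) * (sqrt s * s ^ n)"
    by (intro mult_left_mono) auto
  also have "exp (- s) * (sqrt r * r ^ n * exp 1) = sqrt r * r ^ n * (exp (- s) * exp 1)"
    by (simp only: mult_ac)
  also have "exp (- s) * exp 1 = exp (- r)" by (simp add: rs flip: exp_add)
  finally have "exp 1 * (sqrt r * r ^ n * exp (- r)) \<le> exp 1 * (exp (- s) * (sqrt s * s ^ n))"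
    by (intro mult_left_mono) auto
  with Suc.IH have "fact n \<le> exp 1 * (exp (- s) * (sqrt s * s ^ n))"
    unfolding r_def[symmetric] mult.assoc by linarith
  then have "s * fact n \<le> s * (exp 1 * (exp (- s) * (sqrt s * s ^ n)))"
    using rs by (intro mult_left_mono) auto
  then show ?case
    unfolding fact_Suc s_def[symmetric] power_Suc by (simp only: mult_ac)
qed

subsection \<open>A uniform bound for Hermite polynomials\<close>

text \<open>Jordan's inequality: a concave function lies above its chord.\<close>

lemma sin_ge_linear:
  assumes "0 \<le> x" "x \<le> pi / 2"
  shows "sin x \<ge> 2 * x / pi"
proof -
  have "concave_on {0..pi/2} sin"
    by (rule f''_le0_imp_concave[where f' = cos and f'' = "\<lambda>x. - sin x"])
       (auto intro!: derivative_eq_intros sin_ge_zero)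
  from concave_onD_Icc'[OF this, of x] assms show ?thesis by (simp add: field_simps)
qed

text \<open>With midpoint a and half distance b the difference is 2 sin a sin b, and b \<le> a \<le>
  pi - b makes sin b the smaller sine. The quadratic bound is uniform, including 0 and pi, where the
  cosine is flat.\<close>

lemma cos_diff_ge:
  assumes "0 \<le> x" "x \<le> y" "y \<le> pi"
  shows "cos x - cos y \<ge> 2 * (y - x)\<^sup>2 / pi\<^sup>2"
proof -
  define a b where "a = (y + x) / 2" and "b = (y - x) / 2"
  have xy: "x = a - b" "y = a + b" by (auto simp: a_def b_def field_simps)
  have b: "0 \<le> b" "b \<le> pi / 2" using assms by (auto simp: b_def)
  have "sin a - sin b = 2 * sin ((a - b) / 2) * cos ((a + b) / 2)" by (rule sin_diff_sin)
  also have "\<dots> = 2 * sin (x / 2) * cos (y / 2)" by (simp add: xy)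
  also have "\<dots> \<ge> 0" using assms by (intro mult_nonneg_nonneg sin_ge_zero cos_ge_zero) auto
  finally have "sin b \<le> sin a" by simp
  have "0 \<le> 2 * b / pi" using b by simp
  moreover from this have "0 \<le> sin b" using sin_ge_linear[OF b] by linarith
  moreover from this have "0 \<le> sin a" using \<open>sin b \<le> sin a\<close> by linarith
  moreover have "2 * (y - x)\<^sup>2 / pi\<^sup>2 = 2 * ((2 * b / pi) * (2 * b / pi))"
    by (simp add: b_def power2_eq_square field_simps)
  moreover have "2 * ((2 * b / pi) * (2 * b / pi)) \<le> 2 * (sin a * sin b)"
    using calculation sin_ge_linear[OF b] \<open>sin b \<le> sin a\<close>
    by (intro mult_left_mono mult_mono order_trans[OF sin_ge_linear[OF b]]) auto
  moreover have "2 * (sin a * sin b) = cos x - cos y" by (simp add: xy cos_diff cos_add)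
  ultimately show ?thesis by simp
qed

section \<open>The integral of a quartic exponential and the value of Gamma at 5/4\<close>

lemma Gamma_add_one_real: "x > 0 \<Longrightarrow> Gamma (x + 1) = x * Gamma x" for x :: real
  by (intro Gamma_plus1) (auto elim!: nonpos_Ints_cases)

lemma exp_quartic_has_integral:
  assumes "\<kappa> > (0::real)"
  shows "((\<lambda>v. exp (- \<kappa> * v ^ 4)) has_integral Gamma (5/4) / \<kappa> powr (1/4)) {0..}"
proof -
  let ?g = "\<lambda>v::real. \<kappa> * v ^ 4"
  let ?f = "\<lambda>t::real. t powr (1/4 - 1) / exp t"
  have img: "?g ` {0..} = {0..}"
  proof (intro equalityI subsetI)
    fix y :: real assume y: "y \<in> {0..}"
    have "y = ?g (root 4 (y / \<kappa>))" using y assms by (simp add: real_root_pow_pos2)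
    then show "y \<in> ?g ` {0..}" using y assms by (intro image_eqI[of _ _ "root 4 (y / \<kappa>)"]) auto
  qed (use assms in auto)
  have inj: "inj_on ?g {0..}"
    using assms by (intro inj_onI) (auto intro: power_eq_imp_eq_base)
  have G: "(?f has_integral Gamma (1/4)) {0..}" by (rule Gamma_integral_real) simp
  then have "?f absolutely_integrable_on {0..}"
    by (intro nonnegative_absolutely_integrable_1) (auto simp: has_integral_integrable)
  with G have "?f absolutely_integrable_on ?g ` {0..} \<and> integral (?g ` {0..}) ?f = Gamma (1/4)"
    unfolding img by (auto intro: integral_unique)
  then have *: "(\<lambda>v. \<bar>4 * \<kappa> * v ^ 3\<bar> * ?f (?g v)) absolutely_integrable_on {0..} \<and>
      integral {0..} (\<lambda>v. \<bar>4 * \<kappa> * v ^ 3\<bar> * ?f (?g v)) = Gamma (1/4)"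
    by (subst has_absolute_integral_change_of_variables_1'[OF _ _ inj, of "\<lambda>v. 4 * \<kappa> * v ^ 3"])
       (auto intro!: derivative_eq_intros)
  from integrable_integral[OF set_lebesgue_integral_eq_integral(1)[OF conjunct1[OF *]]]
  have A: "((\<lambda>v. \<bar>4 * \<kappa> * v ^ 3\<bar> * ?f (?g v)) has_integral Gamma (1/4)) {0..}"
    unfolding conjunct2[OF *] .
  \<comment> \<open>At v = 0 the right side is 0 while the left side is positive; the single point
    is then discarded as negligible.\<close>
  have B: "4 * \<kappa> powr (1/4) * exp (- \<kappa> * v ^ 4) = \<bar>4 * \<kappa> * v ^ 3\<bar> * ?f (?g v)"
    if "v \<in> {0..} - {0}" for v
  proof -
    have v: "v > 0" using that by auto
    have "(\<kappa> * v ^ 4) powr (1/4 - 1) = \<kappa> powr (1/4 - 1) * (v powr 4) powr (1/4 - 1)"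
      using v assms by (simp add: powr_mult flip: powr_numeral)
    also have "(v powr 4) powr (1/4 - 1) = v powr (-3)" by (simp add: powr_powr)
    also have "\<dots> = 1 / v ^ 3" using v by (simp add: powr_minus powr_numeral divide_inverse)
    also have "\<kappa> powr (1/4 - 1) = \<kappa> powr (1/4) / \<kappa>"
      using assms by (subst powr_diff) simp_all
    finally show ?thesis using v assms by (simp add: exp_minus field_simps)
  qed
  have "((\<lambda>v. 4 * \<kappa> powr (1/4) * exp (- \<kappa> * v ^ 4)) has_integral Gamma (1/4)) {0..}"
    by (rule has_integral_spike_finite[OF _ B A, of "{0}"]) auto
  from has_integral_mult_right[OF this, of "1 / (4 * \<kappa> powr (1/4))"] assms
  have "((\<lambda>v. exp (- \<kappa> * v ^ 4)) has_integral Gamma (1/4) / (4 * \<kappa> powr (1/4))) {0..}"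
    by simp
  moreover have "Gamma (1/4 :: real) = 4 * Gamma (5/4)"
    using Gamma_add_one_real[of "1/4"] by simp
  then have "Gamma (1/4) / (4 * \<kappa> powr (1/4)) = Gamma (5/4) / \<kappa> powr (1/4)"
    by (simp only:)
  ultimately show ?thesis by (simp only:)
qed

text \<open>Log-convexity is applied at 9/4, the midpoint of 2 and 5/2, and the functional equation
  leads back to 5/4. Interpolating directly between 1 and 3/2 gives only Gamma(5/4)^2 \<le>
  sqrt(pi)/2, about 0.886 instead of 0.851, which is too weak for the constant 2.16.\<close>

lemma Gamma_five_fourths_bound: "Gamma (5/4 :: real) ^ 4 \<le> 144/625 * pi"
proof -
  have G94: "Gamma (9/4 :: real) = 5/4 * Gamma (5/4)"
    using Gamma_add_one_real[of "5/4"] by simp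
  have "Gamma (3/2 :: real) = 1/2 * Gamma (1/2)" "Gamma (5/2 :: real) = 3/2 * Gamma (3/2)"
    using Gamma_add_one_real[of "1/2"] Gamma_add_one_real[of "3/2"] by simp_all
  then have G52: "Gamma (5/2 :: real) = 3/4 * sqrt pi" by (simp add: Gamma_one_half_real)
  have G2: "Gamma (2::real) = 1" by (simp add: Gamma_numeral)
  have "(ln \<circ> Gamma) ((1 - 1/2) *\<^sub>R 2 + (1/2) *\<^sub>R (5/2 :: real))
      \<le> (1 - 1/2) * (ln \<circ> Gamma) 2 + 1/2 * (ln \<circ> Gamma) (5/2)"
    by (rule convex_onD[OF log_convex_Gamma_real]) auto
  then have "2 * ln (Gamma (9/4 :: real)) \<le> ln (Gamma (5/2 :: real))" by (simp add: G2)
  moreover have "ln ((Gamma (9/4 :: real))\<^sup>2) = 2 * ln (Gamma (9/4 :: real))"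
    by (subst ln_realpow) auto
  ultimately have "(Gamma (9/4 :: real))\<^sup>2 \<le> 3/4 * sqrt pi"
    using Gamma_real_pos[of "9/4"] Gamma_real_pos[of "5/2"]
    unfolding G52[symmetric] by (subst ln_le_cancel_iff[symmetric]) (auto simp del: Gamma_real_pos)
  then have "((Gamma (9/4 :: real))\<^sup>2)\<^sup>2 \<le> (3/4 * sqrt pi)\<^sup>2" by (intro power_mono) auto
  also have "(3/4 * sqrt pi)\<^sup>2 = 9/16 * pi"
    unfolding power_mult_distrib by (simp add: power2_eq_square)
  also have "((Gamma (9/4 :: real))\<^sup>2)\<^sup>2 = 625/256 * Gamma (5/4) ^ 4"
    unfolding G94 power_mult_distrib power_mult[symmetric] by (simp add: power4_eq_xxxx)
  finally show ?thesis by simp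
qed


text \<open>The bound is uniform in c because c may be replaced by the nearest value \<rho> cos
  \<phi> of the oscillating term. On each half of the unit interval the integrand then stays below a
  quartic bump, centred at s or at 1 - s, and each bump consists of two half bumps of mass
  \<open>I\<close>.\<close>

lemma integral_exp_cos_bound:
  fixes c \<rho> :: real
  assumes "\<rho> > 0"
  shows "integral {0..1} (\<lambda>t. exp (- (\<rho> * cos (2 * pi * t) - c)\<^sup>2))
      \<le> sqrt 2 * Gamma (5/4) / sqrt \<rho>"
proof -
  \<comment> \<open>This is (8 \<rho>)^2: the factor 8 = 2 (2 pi)^2 / pi^2 comes from
    \<open>cos_diff_ge\<close> at x = 2 pi t, and the exponent squares it.\<close>
  define \<kappa> where "\<kappa> = 64 * \<rho>\<^sup>2"
  define k where "k = (\<lambda>v. indicator {0..} v * exp (- \<kappa> * v ^ 4))"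
  define h where "h = (\<lambda>v::real. exp (- \<kappa> * v ^ 4))"
  define I where "I = Gamma (5/4) / \<kappa> powr (1/4)"
  define F where "F = (\<lambda>t. exp (- (\<rho> * cos (2 * pi * t) - c)\<^sup>2))"
  have \<kappa>: "\<kappa> > 0" using assms by (simp add: \<kappa>_def)
  have [measurable]: "k \<in> borel_measurable borel" unfolding k_def by measurable
  have k0: "k v \<ge> 0" for v by (simp add: k_def)
  have kI: "(\<integral>\<^sup>+v. ennreal (k v) \<partial>lborel) = ennreal I"
    unfolding k_def I_def
    by (intro nn_integral_has_integral_lebesgue exp_quartic_has_integral \<kappa>) auto
  have kI1: "(\<integral>\<^sup>+v. ennreal (k (v - s)) \<partial>lborel) = ennreal I" for s
    using nn_integral_real_affine[of "\<lambda>v. ennreal (k v)" 1 "- s"] kI by (simp add: algebra_simps)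
  have kI2: "(\<integral>\<^sup>+v. ennreal (k (s - v)) \<partial>lborel) = ennreal I" for s
    using nn_integral_real_affine[of "\<lambda>v. ennreal (k v)" "-1" s] kI by simp
  \<comment> \<open>\<open>\<rho> * cos \<phi>\<close> is the projection of c onto
    [-\<rho>, \<rho>]; projecting does not increase the distance to points of that interval.\<close>
  define \<phi> where "\<phi> = (if c > \<rho> then 0 else if c < - \<rho> then pi else arccos (c / \<rho>))"
  have \<phi>: "0 \<le> \<phi>" "\<phi> \<le> pi"
    using assms by (auto simp: \<phi>_def intro!: arccos_lbound arccos_ubound simp: field_simps)
  have near: "\<bar>\<rho> * cos x - c\<bar> \<ge> \<rho> * \<bar>cos x - cos \<phi>\<bar>" for x
  proof -
    consider "c > \<rho>" | "c < - \<rho>" | "- \<rho> \<le> c" "c \<le> \<rho>" by linarith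
    then show ?thesis
    proof cases
      case 1
      have "\<rho> * cos x \<le> \<rho> * 1" using assms by (intro mult_left_mono) auto
      then have "\<bar>\<rho> * cos x - c\<bar> = c - \<rho> * cos x" using 1 by simp
      moreover have "\<rho> * \<bar>cos x - cos \<phi>\<bar> = \<rho> - \<rho> * cos x"
        using 1 by (simp add: \<phi>_def abs_of_nonpos right_diff_distrib)
      ultimately show ?thesis using 1 by simp
    next
      case 2
      have "\<rho> * cos x \<ge> \<rho> * (-1)" using assms by (intro mult_left_mono) auto
      then have "\<bar>\<rho> * cos x - c\<bar> = \<rho> * cos x - c" using 2 by simp
      moreover have "\<bar>cos x + 1\<bar> = cos x + 1" using cos_ge_minus_one[of x] by linarith
      then have "\<rho> * \<bar>cos x - cos \<phi>\<bar> = \<rho> * cos x + \<rho>"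
        using 2 assms by (simp add: \<phi>_def distrib_left)
      ultimately show ?thesis using 2 by simp
    next
      case 3
      then have "cos \<phi> = c / \<rho>" using assms by (simp add: \<phi>_def field_simps)
      then have "\<rho> * cos x - c = \<rho> * (cos x - cos \<phi>)" using assms by (simp add: field_simps)
      then show ?thesis using assms by (simp add: abs_mult)
    qed
  qed
  define s where "s = \<phi> / (2 * pi)"
  have half: "F t \<le> h (t - s)" if "0 \<le> t" "t \<le> 1/2" for t
  proof -
    have r: "2 * pi * t \<ge> 0" "2 * pi * t \<le> pi" using that by auto
    have "2 * (\<phi> - 2 * pi * t)\<^sup>2 / pi\<^sup>2 \<le> \<bar>cos (2 * pi * t) - cos \<phi>\<bar>"
      using cos_diff_ge[OF r(1) _ \<phi>(2)] cos_diff_ge[OF \<phi>(1) _ r(2)]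
      by (cases "2 * pi * t \<le> \<phi>") (auto simp: power2_commute)
    also have "2 * (\<phi> - 2 * pi * t)\<^sup>2 / pi\<^sup>2 = 8 * (t - s)\<^sup>2"
      by (simp add: s_def power2_eq_square field_simps)
    finally have "\<rho> * (8 * (t - s)\<^sup>2) \<le> \<rho> * \<bar>cos (2 * pi * t) - cos \<phi>\<bar>"
      using assms by (intro mult_left_mono) auto
    also have "\<dots> \<le> \<bar>\<rho> * cos (2 * pi * t) - c\<bar>" by (rule near)
    finally have "(\<rho> * (8 * (t - s)\<^sup>2))\<^sup>2 \<le> \<bar>\<rho> * cos (2 * pi * t) - c\<bar>\<^sup>2"
      using assms by (intro power_mono) auto
    moreover have "(\<rho> * (8 * (t - s)\<^sup>2))\<^sup>2 = \<kappa> * (t - s) ^ 4"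
      by (simp add: \<kappa>_def power_mult_distrib flip: power_mult)
    ultimately show ?thesis by (simp add: F_def h_def)
  qed
  \<comment> \<open>Only an inequality: at v = 0 both half bumps count.\<close>
  have hk: "h v \<le> k v + k (- v)" for v
    by (auto simp: h_def k_def indicator_def)
  have bound: "F t \<le> k (t - s) + k (s - t) + (k (t - (1 - s)) + k ((1 - s) - t))"
    if "0 \<le> t" "t \<le> 1" for t
  proof (cases "t \<le> 1/2")
    case True
    then show ?thesis using half[OF that(1)] hk[of "t - s"] k0[of "t - (1 - s)"] k0[of "(1 - s) - t"]
      by simp
  next
    case False
    have "cos (2 * pi * (1 - t)) = cos (2 * pi * t)"
      by (simp add: right_diff_distrib cos_diff)
    then have "F t = F (1 - t)" by (simp add: F_def)
    also have "\<dots> \<le> h (1 - t - s)" using that False by (intro half) auto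
    also have "\<dots> \<le> k (1 - t - s) + k (- (1 - t - s))" by (rule hk)
    finally show ?thesis using k0[of "t - s"] k0[of "s - t"] by (simp add: algebra_simps)
  qed
  have F: "(F has_integral integral {0..1} F) {0..1}"
    unfolding F_def by (intro integrable_integral integrable_continuous_real continuous_intros)
  have "ennreal (integral {0..1} F) = (\<integral>\<^sup>+t. ennreal (indicator {0..1} t * F t) \<partial>lborel)"
    by (rule nn_integral_has_integral_lebesgue[OF _ F, symmetric]) (simp add: F_def)
  also have "\<dots> \<le> (\<integral>\<^sup>+t. (ennreal (k (t - s)) + ennreal (k (s - t)))
      + (ennreal (k (t - (1 - s))) + ennreal (k ((1 - s) - t))) \<partial>lborel)"
    using bound by (intro nn_integral_mono)
      (auto simp: indicator_def k0 simp flip: ennreal_plus intro!: ennreal_leI)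
  also have "\<dots> = (ennreal I + ennreal I) + (ennreal I + ennreal I)"
    by (simp add: nn_integral_add kI1 kI2)
  also have "\<dots> = ennreal (4 * I)"
    using \<kappa> by (simp add: I_def flip: ennreal_plus)
  finally have "integral {0..1} F \<le> 4 * I"
    using \<kappa> by (subst (asm) ennreal_le_iff) (auto simp: I_def)
  also have "\<kappa> powr (1/4) = 2 * sqrt 2 * sqrt \<rho>"
  proof -
    have "(2 * sqrt 2 * sqrt \<rho>) ^ 4 = ((2 * sqrt 2 * sqrt \<rho>)\<^sup>2)\<^sup>2" by simp
    also have "\<dots> = \<kappa>" using assms by (simp add: \<kappa>_def power_mult_distrib)
    finally have "\<kappa> = (2 * sqrt 2 * sqrt \<rho>) powr 4"
      using assms by (simp flip: powr_numeral)
    then have "\<kappa> powr (1/4) = (2 * sqrt 2 * sqrt \<rho>) powr (4 * (1/4))"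
      by (simp only: powr_powr)
    then show ?thesis using assms by simp
  qed
  then have "4 * I = sqrt 2 * Gamma (5/4) / sqrt \<rho>"
    using assms by (simp add: I_def field_simps)
  finally show ?thesis by (simp add: F_def)
qed

lemma herm_complex_eq_contour_integral:
  fixes y :: real
  assumes "r > 0"
  defines "f \<equiv> (\<lambda>z. exp (of_real y * z - z\<^sup>2 / 2))"
  shows "((\<lambda>u. f u / u ^ Suc n) has_contour_integral (2 * pi * \<i> / fact n * of_real (herm n y)))
           (circlepath 0 r)"
proof -
  have d: "(f has_field_derivative (of_real y - z) * f z) (at z)" for z
    unfolding f_def by (auto intro!: derivative_eq_intros)
  have hol: "f holomorphic_on S" for S
    unfolding f_def by (intro holomorphic_intros) auto
  have "(deriv ^^ n) f 0 = of_real (herm n y)"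
    using higher_deriv_gauss[of f "of_real y" n 0] d by (simp add: f_def herm_of_real)
  with Cauchy_has_contour_integral_higher_derivative_circlepath[of 0 r f 0 n] assms(1) hol
  show ?thesis by (simp add: holomorphic_on_imp_continuous_on)
qed

text \<open>With a = Re z on the circle of radius r, eliminating the imaginary part and completing
  the square gives Re (y z - z^2/2) = r^2/2 + y^2/4 - (a - y/2)^2. The radius is left free
  here.\<close>

lemma herm_integral_bound:
  fixes y :: real
  assumes "r > 0"
  shows "\<bar>herm n y\<bar> \<le> fact n / r ^ n * exp (r\<^sup>2 / 2 + y\<^sup>2 / 4)
    * integral {0..1} (\<lambda>t. exp (- (r * cos (2 * pi * t) - y / 2)\<^sup>2))"
proof -
  define f where "f = (\<lambda>z::complex. exp (of_real y * z - z\<^sup>2 / 2))"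
  define E where "E = (\<lambda>t. complex_of_real r * exp (2 * of_real pi * \<i> * of_real t))"
  define g where "g = (\<lambda>t. f (E t) / E t ^ Suc n * (2 * pi * \<i> * E t))"
  define G where "G = (\<lambda>t. exp (- (r * cos (2 * pi * t) - y / 2)\<^sup>2))"
  have g: "(g has_integral (2 * pi * \<i> / fact n * of_real (herm n y))) {0..1}"
    using herm_complex_eq_contour_integral[OF assms, of y n]
    unfolding has_contour_integral vector_derivative_circlepath
    by (simp add: circlepath g_def f_def E_def mult.assoc)
  have G: "(\<lambda>t. 2 * pi / r ^ n * exp (r\<^sup>2 / 2 + y\<^sup>2 / 4) * G t) integrable_on {0..1}"
    unfolding G_def by (intro integrable_continuous_real continuous_intros)
  have "norm (g t) = 2 * pi / r ^ n * exp (r\<^sup>2 / 2 + y\<^sup>2 / 4) * G t" for t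
  proof -
    have E: "E t = Complex (r * cos (2 * pi * t)) (r * sin (2 * pi * t))"
      by (simp add: E_def complex_eq_iff Re_exp Im_exp)
    have nE: "norm (E t) = r" using assms by (simp add: E_def norm_mult)
    have "Re (of_real y * E t - (E t)\<^sup>2 / 2)
        = y * (r * cos (2 * pi * t)) - ((r * cos (2 * pi * t))\<^sup>2 - (r * sin (2 * pi * t))\<^sup>2) / 2"
      by (simp add: E power2_eq_square)
    also have "(r * sin (2 * pi * t))\<^sup>2 = r\<^sup>2 - (r * cos (2 * pi * t))\<^sup>2"
      by (simp add: power_mult_distrib sin_squared_eq algebra_simps)
    also have "y * (r * cos (2 * pi * t)) - ((r * cos (2 * pi * t))\<^sup>2 - (r\<^sup>2 - (r * cos (2 * pi * t))\<^sup>2)) / 2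
      = (r\<^sup>2 / 2 + y\<^sup>2 / 4) + (- (r * cos (2 * pi * t) - y / 2)\<^sup>2)"
      by (simp add: power2_eq_square field_simps)
    finally have "norm (f (E t)) = exp (r\<^sup>2 / 2 + y\<^sup>2 / 4) * G t"
      by (simp only: f_def norm_exp_eq_Re exp_add G_def)
    then show ?thesis
      using assms nE by (auto simp: g_def norm_mult norm_divide norm_power)
  qed
  then have "norm (integral {0..1} g) \<le> integral {0..1} (\<lambda>t. 2 * pi / r ^ n * exp (r\<^sup>2 / 2 + y\<^sup>2 / 4) * G t)"
    using g G by (intro integral_norm_bound_integral) (auto simp: has_integral_integrable)
  also have "integral {0..1} g = 2 * pi * \<i> / fact n * of_real (herm n y)"
    using g by (rule integral_unique)
  also have "norm \<dots> = 2 * pi / fact n * \<bar>herm n y\<bar>"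
    by (simp add: norm_mult norm_divide)
  finally have "2 * pi * (\<bar>herm n y\<bar> / fact n)
      \<le> 2 * pi * (1 / r ^ n * exp (r\<^sup>2 / 2 + y\<^sup>2 / 4) * integral {0..1} G)"
    by (simp add: mult.assoc)
  then have "\<bar>herm n y\<bar> / fact n \<le> 1 / r ^ n * exp (r\<^sup>2 / 2 + y\<^sup>2 / 4) * integral {0..1} G"
    by (subst (asm) mult_le_cancel_left_pos) auto
  then show ?thesis by (simp add: G_def field_simps)
qed

text \<open>The sharp constant is 1.  Here it comes from Cauchy's formula on the circle of radius \<open>sqrt n\<close>,
  where \<open>\<bar>exp (y z - z\<^sup>2 / 2)\<bar>\<close> is \<open>exp (n / 2 + y\<^sup>2 / 4)\<close> times a bump, together with
  \<open>n! \<le> e n^(n + 1/2) / e^n\<close>.\<close>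

lemma herm_bound:
  fixes y :: real
  shows "\<bar>herm n y\<bar> \<le> 2.16 * sqrt (fact n) * exp (y\<^sup>2 / 4)"
proof (cases "n = 0")
  case True
  have "1 \<le> exp (y\<^sup>2 / 4)" by simp
  then show ?thesis unfolding True by (simp del: one_le_exp_iff)
next
  case False
  define r where "r = sqrt (real n)"
  have r: "r > 0" "r\<^sup>2 = real n" "sqrt (real n) = r" using False by (auto simp: r_def)
  let ?S = "fact n / r ^ n * exp (r\<^sup>2 / 2)"
  have "\<bar>herm n y\<bar> \<le> fact n / r ^ n * exp (r\<^sup>2 / 2 + y\<^sup>2 / 4) * (sqrt 2 * Gamma (5/4) / sqrt r)"
    using herm_integral_bound[OF r(1), of n y] integral_exp_cos_bound[OF r(1), of "y / 2"] r(1)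
    by (elim order_trans) (intro mult_left_mono, auto)
  also have "\<dots> = (fact n / r ^ n * exp (r\<^sup>2 / 2) / sqrt r * (sqrt 2 * Gamma (5/4))) * exp (y\<^sup>2 / 4)"
    by (simp add: exp_add)
  also have "fact n / r ^ n * exp (r\<^sup>2 / 2) / sqrt r * (sqrt 2 * Gamma (5/4)) \<le> 2.16 * sqrt (fact n)"
  proof (rule power2_le_imp_le)
    have rn: "(r ^ n)\<^sup>2 = real n ^ n"
      unfolding r(2)[symmetric] power_mult[symmetric] by (simp add: mult.commute)
    have "(fact n / r ^ n * exp (r\<^sup>2 / 2) / sqrt r)\<^sup>2 = fact n * (fact n / (r * real n ^ n * exp (- real n)))"
    proof -
      have e: "(exp (r\<^sup>2 / 2))\<^sup>2 = exp (real n)" using r(2) by (simp flip: exp_double)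
      have q: "(sqrt r)\<^sup>2 = r" using r(1) by simp
      show ?thesis
        unfolding power_mult_distrib power_divide rn e q exp_minus
        by (simp add: power2_eq_square divide_inverse mult_ac)
    qed
    also have "\<dots> \<le> fact n * exp 1"
      using fact_le_stirling[of n] False r by (intro mult_left_mono) (auto simp: field_simps)
    also have "\<dots> \<le> fact n * (272/100)" using e_less_272 by (intro mult_left_mono) auto
    finally have 1: "(fact n / r ^ n * exp (r\<^sup>2 / 2) / sqrt r)\<^sup>2 \<le> fact n * (272/100)" .
    \<comment> \<open>These decimals produce 2.16: with e \<le> 2.72 and Gamma(5/4)^2 \<le> 0.8512
      the squared constant is at most 2.72 * 2 * 0.8512 < 4.631, below 2.16^2 = 4.6656.\<close>
    have "((Gamma (5/4 :: real))\<^sup>2)\<^sup>2 \<le> 144/625 * pi"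
      using Gamma_five_fourths_bound by (simp flip: power_mult)
    also have "\<dots> \<le> (0.8512::real)\<^sup>2" using pi_approx(2) by (simp add: power2_eq_square)
    finally have "(Gamma (5/4 :: real))\<^sup>2 \<le> 0.8512" by (rule power2_le_imp_le) auto
    then have "(sqrt 2 * Gamma (5/4))\<^sup>2 \<le> 2 * 0.8512" by (simp add: power_mult_distrib)
    with 1 have "(fact n / r ^ n * exp (r\<^sup>2 / 2) / sqrt r)\<^sup>2 * (sqrt 2 * Gamma (5/4))\<^sup>2
        \<le> (fact n * (272/100)) * (2 * 0.8512)" by (intro mult_mono) auto
    also have "\<dots> \<le> (2.16)\<^sup>2 * fact n" by (simp add: power2_eq_square)
    finally show "(fact n / r ^ n * exp (r\<^sup>2 / 2) / sqrt r * (sqrt 2 * Gamma (5/4)))\<^sup>2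
        \<le> (2.16 * sqrt (fact n))\<^sup>2"
      unfolding power_mult_distrib[of _ "sqrt 2 * Gamma (5/4)"] power_mult_distrib[of "2.16"] by simp
  qed auto
  finally show ?thesis by (simp add: mult_right_mono)
qed

subsection \<open>Mehler's formula\<close>

lemma summable_linear_coeff:
  fixes a :: "nat \<Rightarrow> real"
  assumes "\<And>n. \<bar>a n\<bar> \<le> B * real (n + 2)" "\<bar>s\<bar> < 1"
  shows "summable (\<lambda>n. a n * s ^ n)"
proof (rule summable_comparison_test')
  have "summable (\<lambda>n. diffs (\<lambda>_. 1::real) n * \<bar>s\<bar> ^ n)"
    using assms(2) by (intro termdiff_converges[of _ 1]) (auto intro: summable_geometric)
  then have "summable (\<lambda>n. real (Suc n) * \<bar>s\<bar> ^ n)" by (simp add: diffs_def)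
  moreover have "summable (\<lambda>n. \<bar>s\<bar> ^ n)" using assms(2) by (intro summable_geometric) auto
  ultimately have "summable (\<lambda>n. real (Suc n) * \<bar>s\<bar> ^ n + \<bar>s\<bar> ^ n)" by (rule summable_add)
  then show "summable (\<lambda>n. B * (real (n + 2) * \<bar>s\<bar> ^ n))"
    by (intro summable_mult) (simp add: algebra_simps)
  show "norm (a n * s ^ n) \<le> B * (real (n + 2) * \<bar>s\<bar> ^ n)" if "n \<ge> 0" for n
    using mult_right_mono[OF assms(1)[of n], of "\<bar>s\<bar> ^ n"] by (simp add: abs_mult power_abs mult_ac)
qed

lemma sums_shift_power:
  fixes a b :: "nat \<Rightarrow> real"
  assumes "(\<lambda>n. a n * s ^ n) sums A" and "b 0 = 0" "\<And>n. b (Suc n) = a n"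
  shows "(\<lambda>n. b n * s ^ n) sums (s * A)"
proof -
  have "(\<lambda>n. b (Suc n) * s ^ Suc n) sums (s * A)"
    using sums_mult[OF assms(1), of s] by (simp add: assms(3) mult_ac)
  from sums_Suc[OF this] show ?thesis by (simp add: assms(2))
qed

lemma mult_Suc_div_fact: "real (Suc n) * a / fact (Suc n) = a / fact n"
  unfolding fact_Suc by (rule mult_divide_mult_cancel_left) simp

lemma herm_prod_bound:
  fixes x y :: real
  shows "\<bar>herm (n + i) x * herm (n + j) y / fact n\<bar>
    \<le> 2.16\<^sup>2 * exp (x\<^sup>2 / 4 + y\<^sup>2 / 4) * (sqrt (fact (n + i) / fact n) * sqrt (fact (n + j) / fact n))"
proof -
  have "\<bar>herm (n + i) x\<bar> * \<bar>herm (n + j) y\<bar>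
      \<le> (2.16 * sqrt (fact (n + i)) * exp (x\<^sup>2 / 4)) * (2.16 * sqrt (fact (n + j)) * exp (y\<^sup>2 / 4))"
    by (intro mult_mono herm_bound) auto
  then have "\<bar>herm (n + i) x\<bar> * \<bar>herm (n + j) y\<bar> / fact n
      \<le> (2.16 * sqrt (fact (n + i)) * exp (x\<^sup>2 / 4)) * (2.16 * sqrt (fact (n + j)) * exp (y\<^sup>2 / 4)) / fact n"
    by (intro divide_right_mono) auto
  also have "\<dots> = 2.16\<^sup>2 * (exp (x\<^sup>2 / 4) * exp (y\<^sup>2 / 4)) * (sqrt (fact (n + i)) * sqrt (fact (n + j)) / fact n)"
    by (simp add: power2_eq_square)
  also have "sqrt (fact (n + i)) * sqrt (fact (n + j)) / fact n
      = sqrt (fact (n + i) / fact n) * sqrt (fact (n + j) / fact n)"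
    by (simp add: real_sqrt_divide)
  finally show ?thesis by (simp add: abs_mult exp_add)
qed

text \<open>An index shift by 1 or 2 costs a factor sqrt(n + 1) or sqrt((n + 1)(n + 2)), so a total
  shift of at most 2 leaves coefficients of linear growth. This covers all series in the
  differential equation for Mehler's sum.\<close>

lemma herm_prod_summable:
  fixes x y s :: real
  assumes "\<bar>s\<bar> < 1" "i + j \<le> 2"
  shows "summable (\<lambda>n. herm (n + i) x * herm (n + j) y / fact n * s ^ n)"
proof (rule summable_linear_coeff[OF _ assms(1)])
  fix n
  have f: "fact (Suc (Suc n)) / fact n = (real n + 2) * (real n + 1)" "fact (Suc n) / fact n = real n + 1"
    by (simp_all add: field_simps)
  have s: "sqrt ((real n + 2) * (real n + 1)) \<le> real n + 2"
    by (rule real_le_lsqrt) (auto simp: power2_eq_square algebra_simps)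
  have s1: "sqrt (real n + 1) \<le> real n + 2" using s by (intro real_le_lsqrt) (auto simp: power2_eq_square algebra_simps)
  have "(i, j) \<in> {(0,0), (0,1), (0,2), (1,0), (1,1), (2,0)}" using assms(2) by auto
  then have *: "sqrt (fact (n + i) / fact n) * sqrt (fact (n + j) / fact n) \<le> real (n + 2)"
    using s s1 by (auto simp: f numeral_2_eq_2 simp del: fact_Suc)
  have "\<bar>herm (n + i) x * herm (n + j) y / fact n\<bar> \<le> 2.16\<^sup>2 * exp (x\<^sup>2 / 4 + y\<^sup>2 / 4)
      * (sqrt (fact (n + i) / fact n) * sqrt (fact (n + j) / fact n))"
    by (rule herm_prod_bound)
  also have "\<dots> \<le> 2.16\<^sup>2 * exp (x\<^sup>2 / 4 + y\<^sup>2 / 4) * real (n + 2)"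
    by (intro mult_left_mono *) auto
  finally show "\<bar>herm (n + i) x * herm (n + j) y / fact n\<bar>
      \<le> 2.16\<^sup>2 * exp (x\<^sup>2 / 4 + y\<^sup>2 / 4) * real (n + 2)" .
qed

text \<open>Mehler's formula: both sides solve the same linear differential equation in \<open>s\<close>.\<close>

lemma mehler:
  fixes x y s :: real
  assumes s: "\<bar>s\<bar> < 1"
  shows "(\<lambda>n. herm n x * herm n y / fact n * s ^ n) sums
    (exp ((s * x * y - s\<^sup>2 * (x\<^sup>2 + y\<^sup>2) / 2) / (1 - s\<^sup>2)) / sqrt (1 - s\<^sup>2))"
proof -
  \<comment> \<open>The Hermite indices are shifted by i and j, the factorial is not. Hence
    \<open>F 0 0\<close> is Mehler's sum and \<open>F 1 1\<close> is its derivative in s.\<close>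
  define c where "c i j x y n = herm (n + i) x * herm (n + j) y / fact n" for i j n and x y :: real
  define F where "F i j x y s = (\<Sum>n. c i j x y n * s ^ n)" for i j and x y s :: real
  have sm: "summable (\<lambda>n. c i j x y n * s ^ n)" if "\<bar>s\<bar> < 1" "i + j \<le> 2" for i j and x y s :: real
    unfolding c_def using that by (rule herm_prod_summable)
  have F_swap: "F i j x y s = F j i y x s" for i j x y s
    by (simp add: F_def c_def mult.commute)
  have sums: "(\<lambda>n. c i j x y n * s ^ n) sums F i j x y s" if "\<bar>s\<bar> < 1" "i + j \<le> 2" for i j and x y s :: real
    unfolding F_def by (intro summable_sums sm that)
  have rec: "real n * herm (n - 1) x = x * herm n x - herm (n + 1) x" for n x
    by (cases n) auto
  \<comment> \<open>P, Q, R and S are the three-term recurrence summed against s^n. They form a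
    linear system for \<open>F 1 0\<close>, \<open>F 0 1\<close>, \<open>F 0 2\<close> and
    \<open>F 1 1\<close>; as 1 - s^2 > 0, it determines \<open>F 1 1\<close> as a multiple of
    \<open>F 0 0\<close>.\<close>
  have P: "F 1 0 x y s = x * F 0 0 x y s - s * F 0 1 x y s" if s: "\<bar>s\<bar> < 1" for x y s
  proof -
    define b where "b n = real n * (herm (n - 1) x * herm n y) / fact n" for n
    have b: "b n = x * c 0 0 x y n - c 1 0 x y n" for n
      unfolding b_def mult.assoc[symmetric] rec by (simp add: c_def left_diff_distrib diff_divide_distrib)
    have "(\<lambda>n. b n * s ^ n) sums (s * F 0 1 x y s)"
      by (rule sums_shift_power[OF sums[OF s]]) (auto simp: b_def c_def mult_Suc_div_fact simp del: of_nat_Suc fact_Suc)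
    moreover have "(\<lambda>n. b n * s ^ n) sums (x * F 0 0 x y s - F 1 0 x y s)"
      unfolding b left_diff_distrib mult.assoc by (intro sums_diff sums_mult sums s) auto
    ultimately have "s * F 0 1 x y s = x * F 0 0 x y s - F 1 0 x y s" by (rule sums_unique2)
    then show ?thesis by simp
  qed
  have Q: "F 0 1 x y s = y * F 0 0 x y s - s * F 1 0 x y s" if s: "\<bar>s\<bar> < 1" for x y s
    using P[OF s, of y x] F_swap by metis
  have R: "F 1 1 x y s = x * F 0 1 x y s - s * F 0 2 x y s" if s: "\<bar>s\<bar> < 1" for x y s
  proof -
    define b where "b n = real n * (herm (n - 1) x * herm (n + 1) y) / fact n" for n
    have b: "b n = x * c 0 1 x y n - c 1 1 x y n" for n
      unfolding b_def mult.assoc[symmetric] rec by (simp add: c_def left_diff_distrib diff_divide_distrib)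
    have "(\<lambda>n. b n * s ^ n) sums (s * F 0 2 x y s)"
      by (rule sums_shift_power[OF sums[OF s]])
         (auto simp: b_def c_def mult_Suc_div_fact numeral_2_eq_2 simp del: of_nat_Suc fact_Suc herm.simps)
    moreover have "(\<lambda>n. b n * s ^ n) sums (x * F 0 1 x y s - F 1 1 x y s)"
      unfolding b left_diff_distrib mult.assoc by (intro sums_diff sums_mult sums s) auto
    ultimately have "s * F 0 2 x y s = x * F 0 1 x y s - F 1 1 x y s" by (rule sums_unique2)
    then show ?thesis by simp
  qed
  have S: "F 0 2 x y s = y * F 0 1 x y s - (F 0 0 x y s + s * F 1 1 x y s)" if s: "\<bar>s\<bar> < 1" for x y s
  proof -
    define b where "b n = real n * (herm n x * herm n y) / fact n" for n
    have b: "b n = y * c 0 1 x y n - c 0 2 x y n - c 0 0 x y n" for n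
    proof -
      have "real n * herm n y = y * herm (n + 1) y - herm (n + 2) y - herm n y"
        by (simp add: algebra_simps)
      moreover have "real n * (herm n x * herm n y) = herm n x * (real n * herm n y)"
        by (rule mult.left_commute)
      ultimately have "real n * (herm n x * herm n y)
          = herm n x * (y * herm (n + 1) y - herm (n + 2) y - herm n y)"
        by (simp only:)
      then show ?thesis
        unfolding b_def by (simp add: c_def right_diff_distrib diff_divide_distrib del: herm.simps)
    qed
    have "(\<lambda>n. b n * s ^ n) sums (s * F 1 1 x y s)"
      by (rule sums_shift_power[OF sums[OF s]])
         (auto simp: b_def c_def mult_Suc_div_fact simp del: of_nat_Suc fact_Suc herm.simps)
    moreover have "(\<lambda>n. b n * s ^ n) sums (y * F 0 1 x y s - F 0 2 x y s - F 0 0 x y s)"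
      unfolding b left_diff_distrib mult.assoc by (intro sums_diff sums_mult sums s) auto
    ultimately have "s * F 1 1 x y s = y * F 0 1 x y s - F 0 2 x y s - F 0 0 x y s" by (rule sums_unique2)
    then show ?thesis by simp
  qed
  have dF: "((\<lambda>s. F 0 0 x y s) has_real_derivative F 1 1 x y s) (at s)" if s: "\<bar>s\<bar> < 1" for s
  proof -
    obtain r where r: "\<bar>s\<bar> < r" "r < 1" using dense[OF s] by auto
    have "((\<lambda>s. \<Sum>n. c 0 0 x y n * s ^ n) has_real_derivative (\<Sum>n. diffs (c 0 0 x y) n * s ^ n)) (at s)"
      by (rule termdiffs_strong[of _ r]) (use sm[of r 0 0] r in auto)
    also have "diffs (c 0 0 x y) = c 1 1 x y"
      unfolding diffs_def c_def add_0_right Suc_eq_plus1[symmetric] times_divide_eq_right mult_Suc_div_fact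
      by (simp add: mult_Suc_div_fact del: herm.simps of_nat_Suc fact_Suc)
    finally show ?thesis by (simp add: F_def)
  qed
  define E where "E s = (s * x * y - s\<^sup>2 * (x\<^sup>2 + y\<^sup>2) / 2) / (1 - s\<^sup>2)" for s
  define E' where "E' s = (x - s * y) * (y - s * x) / (1 - s\<^sup>2)\<^sup>2" for s
  have pos: "1 - s\<^sup>2 > 0" if "\<bar>s\<bar> < 1" for s :: real
    using that by (simp add: abs_square_less_1)
  \<comment> \<open>The factor is the logarithmic derivative of the closed form: \<open>E'\<close>
    belongs to the exponent and s/(1 - s^2) to the inverse square root.\<close>
  have F11: "F 1 1 x y s = (E' s + s / (1 - s\<^sup>2)) * F 0 0 x y s" if s: "\<bar>s\<bar> < 1" for s
  proof -
    define D where "D = 1 - s\<^sup>2"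
    have D: "D > 0" "D * z = z - s * (s * z)" for z
      using pos[OF s] by (auto simp: D_def algebra_simps power2_eq_square)
    have "F 0 1 x y s = y * F 0 0 x y s - s * (x * F 0 0 x y s - s * F 0 1 x y s)"
      using P[OF s, of x y] Q[OF s, of x y] by metis
    then have "D * F 0 1 x y s = (y - s * x) * F 0 0 x y s"
      unfolding D(2) by (simp add: algebra_simps)
    then have 1: "F 0 1 x y s = (y - s * x) * F 0 0 x y s / D"
      using D(1) by (simp add: field_simps)
    have "F 1 1 x y s = x * F 0 1 x y s - s * (y * F 0 1 x y s - (F 0 0 x y s + s * F 1 1 x y s))"
      using R[OF s, of x y] S[OF s, of x y] by metis
    then have "D * F 1 1 x y s = (x - s * y) * F 0 1 x y s + s * F 0 0 x y s"
      unfolding D(2) by (simp add: algebra_simps)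
    then have "F 1 1 x y s = ((x - s * y) * F 0 1 x y s + s * F 0 0 x y s) / D"
      using D(1) by (simp add: field_simps)
    also have "\<dots> = ((x - s * y) * (y - s * x) / D\<^sup>2 + s / D) * F 0 0 x y s"
      unfolding 1 using D(1) by (simp add: add_divide_distrib distrib_right power2_eq_square)
    finally show ?thesis by (simp add: D_def E'_def)
  qed
  have dE: "(E has_real_derivative E' s) (at s)" if s: "\<bar>s\<bar> < 1" for s
  proof -
    define N where "N s = s * x * y - s\<^sup>2 * (x\<^sup>2 + y\<^sup>2) / 2" for s
    have "(N has_real_derivative (x * y - s * (x\<^sup>2 + y\<^sup>2))) (at s)"
      unfolding N_def by (auto intro!: derivative_eq_intros)
    moreover have "((\<lambda>s. 1 - s\<^sup>2) has_real_derivative (- 2 * s)) (at s)"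
      by (auto intro!: derivative_eq_intros)
    ultimately have "((\<lambda>s. N s / (1 - s\<^sup>2)) has_real_derivative
        ((x * y - s * (x\<^sup>2 + y\<^sup>2)) * (1 - s\<^sup>2) - N s * (- 2 * s)) / ((1 - s\<^sup>2) * (1 - s\<^sup>2))) (at s)"
      using pos[OF s] by (intro DERIV_divide) auto
    also have "(x * y - s * (x\<^sup>2 + y\<^sup>2)) * (1 - s\<^sup>2) - N s * (- 2 * s) = (x - s * y) * (y - s * x)"
      unfolding N_def by (simp add: power2_eq_square field_simps)
    finally show ?thesis by (simp add: E_def[abs_def] E'_def N_def power2_eq_square)
  qed
  \<comment> \<open>The quotient of the two sides: constant on (-1, 1), with value 1 at s =
    0.\<close>
  define T where "T s = F 0 0 x y s * (sqrt (1 - s\<^sup>2) * exp (- E s))" for s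
  have dT: "(T has_real_derivative 0) (at s)" if s: "\<bar>s\<bar> < 1" for s
  proof -
    have sq: "((\<lambda>s. sqrt (1 - s\<^sup>2)) has_real_derivative - s / sqrt (1 - s\<^sup>2)) (at s)"
      using pos[OF s] by (auto intro!: derivative_eq_intros simp: field_simps)
    have "(T has_real_derivative (F 1 1 x y s * (sqrt (1 - s\<^sup>2) * exp (- E s))
        + (- s / sqrt (1 - s\<^sup>2) * exp (- E s) + exp (- E s) * (- E' s) * sqrt (1 - s\<^sup>2)) * F 0 0 x y s)) (at s)"
      unfolding T_def
      by (intro DERIV_mult dF[OF s] sq DERIV_fun_exp DERIV_minus dE[OF s])
    also have "- s / sqrt (1 - s\<^sup>2) = - s / (1 - s\<^sup>2) * sqrt (1 - s\<^sup>2)"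
      using pos[OF s] real_sqrt_mult_self[of "1 - s\<^sup>2"] by (simp add: divide_simps)
    also have "F 1 1 x y s * (sqrt (1 - s\<^sup>2) * exp (- E s))
        + (- s / (1 - s\<^sup>2) * sqrt (1 - s\<^sup>2) * exp (- E s)
          + exp (- E s) * (- E' s) * sqrt (1 - s\<^sup>2)) * F 0 0 x y s = 0"
      unfolding F11[OF s] by (simp add: algebra_simps)
    finally show ?thesis .
  qed
  have "(T has_real_derivative 0) (at s within {-1<..<1})" if "s \<in> {-1<..<1}" for s
    by (rule has_field_derivative_at_within[OF dT]) (use that in auto)
  then have "\<exists>k. \<forall>s\<in>{-1<..<1}. T s = k"
    by (rule has_field_derivative_zero_constant[OF convex_real_interval(8)])
  then obtain k where k: "\<And>s. s \<in> {-1<..<1} \<Longrightarrow> T s = k" by blast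
  have "T s = T 0" using k[of s] k[of 0] s by (simp add: abs_less_iff)
  moreover have "F 0 0 x y 0 = 1"
    using powser_sums_zero[of "c 0 0 x y"] by (simp add: F_def sums_iff c_def)
  ultimately have "F 0 0 x y s * (sqrt (1 - s\<^sup>2) * exp (- E s)) = 1"
    by (simp add: T_def E_def)
  then have "F 0 0 x y s = exp (E s) / sqrt (1 - s\<^sup>2)"
    using pos[OF s] by (simp add: field_simps exp_minus)
  then show ?thesis
    using summable_sums[OF sm[OF s, of 0 0 x y]] by (simp add: F_def E_def c_def)
qed

subsection \<open>Gaussian means of Hermite polynomials\<close>

text \<open>Stein's identity for a monomial, read off from the known moments. The truncated
  \<open>k - 1\<close> at k = 0 is multiplied by 0.\<close>

lemma std_normal_stein_power:
  "(\<integral>x. x ^ (k + 1) \<partial>std_normal_distribution) = real k * (\<integral>x. x ^ (k - 1) \<partial>std_normal_distribution)"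
proof (cases "even k")
  case True
  have "odd (k + 1)" "k > 0 \<Longrightarrow> odd (k - 1)" using True by auto
  then show ?thesis
    using integral_std_normal_distribution_moment_odd[of "k + 1"]
      integral_std_normal_distribution_moment_odd[of "k - 1"] by (cases "k = 0") simp_all
next
  case False
  then obtain j where k: "k = 2 * j + 1" by (elim oddE)
  define r where "r = real (Suc j)"
  have r: "r > 0" "real k = 2 * r - 1" by (auto simp: r_def k)
  have "fact (2 * Suc j) = 2 * r * (2 * r - 1) * fact (2 * j)" by (simp add: r_def algebra_simps)
  moreover have "fact (Suc j) = r * fact j" by (simp add: r_def)
  ultimately have "fact (2 * Suc j) / (2 ^ Suc j * fact (Suc j)) = real k * (fact (2 * j) / (2 ^ j * fact j))"
    using r by (simp del: fact_Suc)
  moreover have "k + 1 = 2 * Suc j" "k - 1 = 2 * j" by (auto simp: k)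
  ultimately show ?thesis by (simp only: std_normal_distribution_even_moments(1))
qed

lemma integrable_std_normal_poly: "integrable std_normal_distribution (\<lambda>x. x ^ k * poly p x)"
proof (induction p arbitrary: k rule: pCons_induct)
  case (pCons a p)
  have "integrable std_normal_distribution (\<lambda>x. a * x ^ k + x ^ Suc k * poly p x)"
    by (intro Bochner_Integration.integrable_add integrable_mult_right
        integrable_std_normal_distribution_moment pCons.IH)
  also have "(\<lambda>x. a * x ^ k + x ^ Suc k * poly p x) = (\<lambda>x. x ^ k * poly (pCons a p) x)"
    by (auto simp: algebra_simps)
  finally show ?case .
qed auto

text \<open>Stein's identity for x^k p(x), the derivative being split by the product rule. The power
  is there for the induction: the factor x that \<open>pCons\<close> puts in front of p is absorbed
  into k.\<close>

lemma std_normal_stein_poly: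
  "(\<integral>x. x ^ (k + 1) * poly p x \<partial>std_normal_distribution)
    = (\<integral>x. real k * (x ^ (k - 1) * poly p x) + x ^ k * poly (pderiv p) x \<partial>std_normal_distribution)"
proof (induction p arbitrary: k rule: pCons_induct)
  case (pCons a p)
  note int = Bochner_Integration.integrable_add integrable_mult_right
        integrable_std_normal_distribution_moment integrable_std_normal_poly
  have "(\<integral>x. x ^ (k + 1) * poly (pCons a p) x \<partial>std_normal_distribution)
      = (\<integral>x. a * x ^ (k + 1) + x ^ (Suc k + 1) * poly p x \<partial>std_normal_distribution)"
    by (simp add: algebra_simps)
  also have "\<dots> = a * (\<integral>x. x ^ (k + 1) \<partial>std_normal_distribution)
      + (\<integral>x. x ^ (Suc k + 1) * poly p x \<partial>std_normal_distribution)"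
    by (subst Bochner_Integration.integral_add) (intro int, intro int, simp)
  also have "\<dots> = (\<integral>x. a * (real k * x ^ (k - 1)) \<partial>std_normal_distribution)
      + (\<integral>x. real (Suc k) * (x ^ k * poly p x) + x ^ Suc k * poly (pderiv p) x \<partial>std_normal_distribution)"
    unfolding std_normal_stein_power pCons.IH by simp
  also have "\<dots> = (\<integral>x. a * (real k * x ^ (k - 1))
      + (real (Suc k) * (x ^ k * poly p x) + x ^ Suc k * poly (pderiv p) x) \<partial>std_normal_distribution)"
    by (rule Bochner_Integration.integral_add[symmetric]) (intro int)+
  also have "(\<lambda>x. a * (real k * x ^ (k - 1))
      + (real (Suc k) * (x ^ k * poly p x) + x ^ Suc k * poly (pderiv p) x))
    = (\<lambda>x. real k * (x ^ (k - 1) * poly (pCons a p) x) + x ^ k * poly (pderiv (pCons a p)) x)"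
    by (cases k) (auto simp: fun_eq_iff pderiv_pCons algebra_simps)
  finally show ?case .
qed auto

lemma herm_scaled_poly: "\<exists>p. poly p = (\<lambda>x::real. herm n (\<gamma> * x))"
proof (induction n rule: less_induct)
  case (less n)
  consider "n = 0" | "n = Suc 0" | m where "n = Suc (Suc m)"
    by (metis old.nat.exhaust)
  then show ?case
  proof cases
    case 1
    then show ?thesis by (intro exI[of _ 1]) auto
  next
    case 2
    then show ?thesis by (intro exI[of _ "[:0, \<gamma>:]"]) (auto simp: mult.commute)
  next
    case 3
    obtain p q where "poly p = (\<lambda>x. herm (Suc m) (\<gamma> * x))" "poly q = (\<lambda>x. herm m (\<gamma> * x))"
      using less[of "Suc m"] less[of m] 3 by auto
    then show ?thesis unfolding 3
      by (intro exI[of _ "[:0, \<gamma>:] * p - smult (real (Suc m)) q"]) (auto simp: fun_eq_iff algebra_simps)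
  qed
qed

lemma
  fixes \<gamma> :: real
  shows integrable_std_normal_herm: "integrable std_normal_distribution (\<lambda>x. herm n (\<gamma> * x))" (is ?A)
    and integrable_std_normal_mult_herm: "integrable std_normal_distribution (\<lambda>x. x * herm n (\<gamma> * x))" (is ?B)
    and std_normal_stein_herm: "(\<integral>x. x * herm n (\<gamma> * x) \<partial>std_normal_distribution)
      = \<gamma> * real n * (\<integral>x. herm (n - 1) (\<gamma> * x) \<partial>std_normal_distribution)" (is ?C)
proof -
  obtain p where p: "poly p = (\<lambda>x. herm n (\<gamma> * x))" using herm_scaled_poly by blast
  show ?A using integrable_std_normal_poly[of 0 p] by (simp add: p)
  show ?B using integrable_std_normal_poly[of 1 p] by (simp add: p)
  have "poly (pderiv p) x = \<gamma> * real n * herm (n - 1) (\<gamma> * x)" for x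
  proof (rule DERIV_unique)
    show "(poly p has_real_derivative poly (pderiv p) x) (at x)" by (rule poly_DERIV)
    have "((\<lambda>x. herm n (\<gamma> * x)) has_real_derivative real n * herm (n - 1) (\<gamma> * x) * \<gamma>) (at x)"
      by (rule DERIV_chain2[OF DERIV_herm]) (auto intro!: derivative_eq_intros)
    then show "(poly p has_real_derivative \<gamma> * real n * herm (n - 1) (\<gamma> * x)) (at x)"
      by (simp add: p mult_ac)
  qed
  then show ?C using std_normal_stein_poly[of 0 p] by (simp add: p)
qed

text \<open>The recurrence and Stein's identity give m(n + 2) = (n + 1) (\<gamma>^2 - 1) m(n) for
  the means m. After squaring, (n + 1)^2 is weakened to (n + 2)(n + 1) to build up the factorial.
  The mean for n = 1 vanishes, and \<gamma>^2 \<ge> 1 makes the bound nonnegative there.\<close>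

lemma std_normal_herm_mean_bound:
  fixes \<gamma> :: real
  assumes "\<gamma>\<^sup>2 \<ge> 1"
  shows "(\<integral>x. herm n (\<gamma> * x) \<partial>std_normal_distribution)\<^sup>2 \<le> fact n * (\<gamma>\<^sup>2 - 1) ^ n"
proof (induction n rule: less_induct)
  case (less n)
  interpret real_distribution std_normal_distribution by (rule real_dist_normal_dist)
  consider "n = 0" | "n = Suc 0" | m where "n = Suc (Suc m)"
    by (metis old.nat.exhaust)
  then show ?case
  proof cases
    case 1
    then show ?thesis using prob_space by simp
  next
    case 2
    then show ?thesis
      using integral_std_normal_distribution_moment_odd[of 1] assms by simp
  next
    case 3
    let ?m = "\<lambda>n. \<integral>x. herm n (\<gamma> * x) \<partial>std_normal_distribution"
    have "?m n = (\<integral>x. \<gamma> * (x * herm (Suc m) (\<gamma> * x)) - real (Suc m) * herm m (\<gamma> * x) \<partial>std_normal_distribution)"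
      by (simp add: 3 mult.assoc)
    also have "\<dots> = \<gamma> * (\<gamma> * real (Suc m) * ?m m) - real (Suc m) * ?m m"
      by (subst Bochner_Integration.integral_diff)
         (auto intro!: integrable_std_normal_herm integrable_std_normal_mult_herm integrable_mult_right
            simp: std_normal_stein_herm simp del: herm.simps of_nat_Suc)
    finally have m: "?m n = real (Suc m) * (\<gamma>\<^sup>2 - 1) * ?m m" by (simp add: power2_eq_square algebra_simps)
    have "(?m n)\<^sup>2 = (real (Suc m) * real (Suc m)) * ((\<gamma>\<^sup>2 - 1)\<^sup>2 * (?m m)\<^sup>2)"
      unfolding m power_mult_distrib by (simp add: power2_eq_square)
    also have "\<dots> \<le> (real (Suc (Suc m)) * real (Suc m)) * ((\<gamma>\<^sup>2 - 1)\<^sup>2 * (fact m * (\<gamma>\<^sup>2 - 1) ^ m))"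
      using less[of m] 3 by (intro mult_mono mult_left_mono) auto
    also have "\<dots> = fact n * (\<gamma>\<^sup>2 - 1) ^ n"
      unfolding 3 fact_Suc power_Suc power2_eq_square by (simp only: mult_ac)
    finally show ?thesis .
  qed
qed

subsection \<open>Parameters of the Mercer expansion\<close>

text \<open>The \<eta> of the theorem for a single length-scale.\<close>

definition mercer_rate :: "real \<Rightarrow> real" where
  "mercer_rate l = sqrt (mercer_lambda l) * exp (1 / (mercer_beta l)\<^sup>2)"

context
  fixes l :: real
  assumes l: "l > 0"
begin

lemma mercer_beta_gt_1: "mercer_beta l > 1"
  unfolding mercer_beta_def mercer_eps_def mercer_alpha_def using l
  by (intro gr_one_powr) auto

text \<open>For \<alpha> = 1/sqrt 2 the definition of \<beta> reads \<beta>^4 = 1 + 8 \<epsilon>^2.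
  It turns \<delta>^2, \<tau> and \<lambda> into rational functions of \<beta>^2; the square root in
  \<tau> disappears because the common denominator is (\<beta>^2 + 1)^2 / 8.\<close>

lemma mercer_eps_sq: "(mercer_eps l)\<^sup>2 = (((mercer_beta l)\<^sup>2)\<^sup>2 - 1) / 8"
proof -
  have "mercer_beta l ^ 4 = 1 + (2 * mercer_eps l / mercer_alpha)\<^sup>2"
    unfolding mercer_beta_def by (subst powr_power) (auto simp: add_nonneg_eq_0_iff)
  also have "(2 * mercer_eps l / mercer_alpha)\<^sup>2 = 8 * (mercer_eps l)\<^sup>2"
    by (simp add: mercer_alpha_def power_mult_distrib)
  finally show ?thesis by simp
qed

lemma mercer_delta_sq_eq: "mercer_delta_sq l = ((mercer_beta l)\<^sup>2 - 1) / 4"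
  by (simp add: mercer_delta_sq_def mercer_alpha_def power_divide)

lemma mercer_denom: "1 / 2 + mercer_delta_sq l + (mercer_eps l)\<^sup>2 = ((mercer_beta l)\<^sup>2 + 1)\<^sup>2 / 8"
  unfolding mercer_eps_sq mercer_delta_sq_eq by (simp add: power2_eq_square field_simps)

lemma mercer_tau_eq: "mercer_tau l = 2 / ((mercer_beta l)\<^sup>2 + 1)"
proof -
  have "mercer_tau l = sqrt ((2 / ((mercer_beta l)\<^sup>2 + 1))\<^sup>2)"
    unfolding mercer_tau_def mercer_denom by (simp add: power_divide)
  then show ?thesis by (simp del: real_sqrt_power)
qed

lemma mercer_lambda_eq: "mercer_lambda l = ((mercer_beta l)\<^sup>2 - 1) / ((mercer_beta l)\<^sup>2 + 1)"
proof -
  define c where "c = (mercer_beta l)\<^sup>2 + 1"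
  have c: "c > 0" "(mercer_beta l)\<^sup>2 = c - 1" by (auto simp: c_def add_nonneg_pos)
  have "(c - 1)\<^sup>2 - 1 = c * (c - 2)" by (simp add: power2_eq_square algebra_simps)
  then show ?thesis
    unfolding mercer_lambda_def mercer_denom unfolding mercer_eps_sq c(2) using c(1)
    by (simp add: power2_eq_square)
qed

lemma mercer_beta_sq_gt_1: "(mercer_beta l)\<^sup>2 > 1"
  using mercer_beta_gt_1 by (simp add: one_less_power)

lemma mercer_lambda_bounds: "0 < mercer_lambda l" "mercer_lambda l < 1"
  using mercer_beta_sq_gt_1 by (auto simp: mercer_lambda_eq field_simps)

lemma mercer_tau_bounds: "0 < mercer_tau l" "mercer_tau l < 1"
  using mercer_beta_sq_gt_1 by (auto simp: mercer_tau_eq field_simps)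

text \<open>By this identity the prefactor of Mehler's formula at s = \<lambda> cancels \<tau> from
  the eigenvalues together with \<beta> from the normalisation of the eigenfunctions.\<close>

lemma mercer_one_minus_lambda_sq: "1 - (mercer_lambda l)\<^sup>2 = (mercer_tau l * mercer_beta l)\<^sup>2"
proof -
  define c where "c = (mercer_beta l)\<^sup>2 + 1"
  have c: "c > 0" "(mercer_beta l)\<^sup>2 = c - 1" by (auto simp: c_def add_nonneg_pos)
  show ?thesis
    unfolding mercer_lambda_eq mercer_tau_eq power_mult_distrib c(2) using c(1)
    by (simp add: power2_eq_square field_simps)
qed

lemma mercer_phi_eq:
  "mercer_phi l n x = sqrt (mercer_beta l / fact n) * exp (- mercer_delta_sq l * x\<^sup>2) * herm n (mercer_beta l * x)"
  by (simp add: mercer_phi_def hermite_eq mercer_alpha_def)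

lemma borel_measurable_mercer_phi [measurable]: "mercer_phi l n \<in> borel_measurable borel"
  unfolding mercer_phi_eq[abs_def] by measurable

lemma gauss_kernel1_eps: "gauss_kernel1 l x y = exp (- (mercer_eps l)\<^sup>2 * (x - y)\<^sup>2)"
  using l by (simp add: gauss_kernel1_def mercer_eps_def power_divide power_mult_distrib field_simps)

lemma mercer_expansion:
  "(\<lambda>n. mercer_tau l * mercer_lambda l ^ n * (mercer_phi l n x * mercer_phi l n y)) sums gauss_kernel1 l x y"
proof -
  define b where "b = (mercer_beta l)\<^sup>2"
  have b: "b > 1" unfolding b_def by (rule mercer_beta_sq_gt_1)
  define \<beta> \<tau> s where "\<beta> = mercer_beta l" and "\<tau> = mercer_tau l" and "s = mercer_lambda l"
  have \<beta>: "\<beta> > 1" "\<beta> * \<beta> = b" using mercer_beta_gt_1 by (auto simp: \<beta>_def b_def power2_eq_square)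
  have \<tau>: "\<tau> > 0" using mercer_tau_bounds by (simp add: \<tau>_def)
  have D: "1 - s\<^sup>2 = (\<tau> * \<beta>)\<^sup>2" unfolding s_def \<tau>_def \<beta>_def by (rule mercer_one_minus_lambda_sq)
  have sb: "s = (b - 1) / (b + 1)" "1 - s\<^sup>2 = 4 * b / (b + 1)\<^sup>2"
    unfolding D \<tau>_def mercer_tau_eq by (auto simp: s_def mercer_lambda_eq b_def \<beta>_def power_mult_distrib power_divide)
  define c where "c = \<tau> * \<beta> * exp (- mercer_delta_sq l * (x\<^sup>2 + y\<^sup>2))"
  have "\<bar>s\<bar> < 1" using mercer_lambda_bounds by (simp add: s_def)
  from sums_mult[OF mehler[OF this, of "\<beta> * x" "\<beta> * y"], of c]
  have "(\<lambda>n. c * (herm n (\<beta> * x) * herm n (\<beta> * y) / fact n * s ^ n)) sums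
    (c * (exp ((s * (\<beta> * x) * (\<beta> * y) - s\<^sup>2 * ((\<beta> * x)\<^sup>2 + (\<beta> * y)\<^sup>2) / 2) / (1 - s\<^sup>2)) / sqrt (1 - s\<^sup>2)))" .
  also have "(\<lambda>n. c * (herm n (\<beta> * x) * herm n (\<beta> * y) / fact n * s ^ n))
    = (\<lambda>n. mercer_tau l * mercer_lambda l ^ n * (mercer_phi l n x * mercer_phi l n y))"
  proof
    fix n
    have "mercer_phi l n x * mercer_phi l n y = (sqrt (\<beta> / fact n) * sqrt (\<beta> / fact n))
        * (exp (- mercer_delta_sq l * x\<^sup>2) * exp (- mercer_delta_sq l * y\<^sup>2))
        * (herm n (\<beta> * x) * herm n (\<beta> * y))"
      unfolding mercer_phi_eq \<beta>_def by (simp only: mult_ac)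
    also have "sqrt (\<beta> / fact n) * sqrt (\<beta> / fact n) = \<beta> / fact n" using \<beta>(1) by simp
    also have "exp (- mercer_delta_sq l * x\<^sup>2) * exp (- mercer_delta_sq l * y\<^sup>2)
        = exp (- mercer_delta_sq l * (x\<^sup>2 + y\<^sup>2))" by (simp add: algebra_simps flip: exp_add)
    finally show "c * (herm n (\<beta> * x) * herm n (\<beta> * y) / fact n * s ^ n)
      = mercer_tau l * mercer_lambda l ^ n * (mercer_phi l n x * mercer_phi l n y)"
      by (simp add: c_def \<tau>_def s_def)
  qed
  also have "sqrt (1 - s\<^sup>2) = \<tau> * \<beta>" unfolding D using \<tau> \<beta> by simp
  also have "c * (exp ((s * (\<beta> * x) * (\<beta> * y) - s\<^sup>2 * ((\<beta> * x)\<^sup>2 + (\<beta> * y)\<^sup>2) / 2) / (1 - s\<^sup>2)) / (\<tau> * \<beta>))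
    = exp ((s * (\<beta> * x) * (\<beta> * y) - s\<^sup>2 * ((\<beta> * x)\<^sup>2 + (\<beta> * y)\<^sup>2) / 2) / (1 - s\<^sup>2)
        + - mercer_delta_sq l * (x\<^sup>2 + y\<^sup>2))"
    unfolding c_def exp_add using \<tau> \<beta> by (simp add: mult.commute)
  also have "(s * (\<beta> * x) * (\<beta> * y) - s\<^sup>2 * ((\<beta> * x)\<^sup>2 + (\<beta> * y)\<^sup>2) / 2) / (1 - s\<^sup>2)
    = (s / (1 - s\<^sup>2) * b) * (x * y) - (s\<^sup>2 / (1 - s\<^sup>2) * b) * ((x\<^sup>2 + y\<^sup>2) / 2)"
    unfolding \<beta>(2)[symmetric] by (simp add: diff_divide_distrib power2_eq_square algebra_simps)
  also have "s / (1 - s\<^sup>2) * b = (b\<^sup>2 - 1) / 4"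
  proof -
    define c where "c = b + 1"
    have "s / (1 - s\<^sup>2) * b = (b - 1) * c / 4"
      unfolding sb(2) unfolding sb(1) c_def[symmetric] using b by (simp add: power2_eq_square)
    then show ?thesis by (simp add: c_def power2_eq_square algebra_simps)
  qed
  also have "s\<^sup>2 / (1 - s\<^sup>2) * b = (b - 1)\<^sup>2 / 4"
    unfolding sb(2) using b by (simp add: sb(1) power_divide)
  \<comment> \<open>The quadratic forms agree: x y has the coefficient (b^2 - 1)/4 = 2 \<epsilon>^2,
    and (b - 1)^2/8 + \<delta>^2 = (b - 1)^2/8 + (b - 1)/4 = (b^2 - 1)/8 = \<epsilon>^2.\<close>
  also have "(b\<^sup>2 - 1) / 4 * (x * y) - (b - 1)\<^sup>2 / 4 * ((x\<^sup>2 + y\<^sup>2) / 2)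
      + - mercer_delta_sq l * (x\<^sup>2 + y\<^sup>2) = - (mercer_eps l)\<^sup>2 * (x - y)\<^sup>2"
    unfolding mercer_delta_sq_eq mercer_eps_sq b_def[symmetric]
    by (simp add: power2_eq_square field_simps)
  finally show ?thesis unfolding gauss_kernel1_eps .
qed

text \<open>The exponents combine to \<beta>^2/4 - \<delta>^2 = 1/4, so the growth in x depends
  neither on n nor on the length-scale.\<close>

lemma mercer_phi_bound: "\<bar>mercer_phi l n x\<bar> \<le> 2.16 * sqrt (mercer_beta l) * exp (x\<^sup>2 / 4)"
proof -
  have b: "mercer_beta l > 0" using mercer_beta_gt_1 by simp
  have "\<bar>mercer_phi l n x\<bar> = sqrt (mercer_beta l / fact n) * exp (- mercer_delta_sq l * x\<^sup>2) * \<bar>herm n (mercer_beta l * x)\<bar>"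
    using b by (simp add: mercer_phi_eq abs_mult)
  also have "\<dots> \<le> sqrt (mercer_beta l / fact n) * exp (- mercer_delta_sq l * x\<^sup>2)
      * (2.16 * sqrt (fact n) * exp ((mercer_beta l * x)\<^sup>2 / 4))"
    using b by (intro mult_left_mono herm_bound) auto
  also have "\<dots> = 2.16 * (sqrt (mercer_beta l / fact n) * sqrt (fact n))
      * (exp (- mercer_delta_sq l * x\<^sup>2) * exp ((mercer_beta l * x)\<^sup>2 / 4))"
    by simp
  also have "sqrt (mercer_beta l / fact n) * sqrt (fact n) = sqrt (mercer_beta l)"
    by (simp flip: real_sqrt_mult)
  also have "exp (- mercer_delta_sq l * x\<^sup>2) * exp ((mercer_beta l * x)\<^sup>2 / 4) = exp (x\<^sup>2 / 4)"
    by (simp add: mercer_delta_sq_eq power2_eq_square field_simps flip: exp_add)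
  finally show ?thesis .
qed

text \<open>Substituting \<sigma> x with \<sigma>^2 = \<tau> absorbs exp(-\<delta>^2 x^2) into the
  normal density, because 1/2 + \<delta>^2 = 1/(2 \<tau>). What remains is the mean of a Hermite
  polynomial scaled by \<beta> \<sigma>, and (\<beta> \<sigma>)^2 - 1 = \<lambda>.\<close>

lemma mercer_phi_mean_bound:
  "(\<integral>x. mercer_phi l n x \<partial>std_normal_distribution)\<^sup>2 \<le> mercer_tau l * mercer_beta l * mercer_lambda l ^ n"
proof -
  define \<beta> \<tau> where "\<beta> = mercer_beta l" and "\<tau> = mercer_tau l"
  have \<beta>: "\<beta> > 1" using mercer_beta_gt_1 by (auto simp: \<beta>_def)
  have \<tau>: "\<tau> > 0" using mercer_tau_bounds by (simp add: \<tau>_def)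
  define \<sigma> where "\<sigma> = sqrt \<tau>"
  have \<sigma>: "\<sigma> > 0" "\<sigma>\<^sup>2 = \<tau>" using \<tau> by (auto simp: \<sigma>_def)
  have dens: "std_normal_density (\<sigma> * x) * mercer_phi l n (\<sigma> * x)
      = sqrt (\<beta> / fact n) * (std_normal_density x * herm n (\<beta> * \<sigma> * x))" for x
  proof -
    have b1: "\<beta>\<^sup>2 + 1 > 0" by (simp add: add_nonneg_pos)
    have "(\<sigma> * x)\<^sup>2 = 2 / (\<beta>\<^sup>2 + 1) * x\<^sup>2"
      by (simp add: power_mult_distrib \<sigma>(2) \<tau>_def mercer_tau_eq \<beta>_def)
    then have "- (\<sigma> * x)\<^sup>2 / 2 + - mercer_delta_sq l * (\<sigma> * x)\<^sup>2 = - x\<^sup>2 / 2"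
      unfolding mercer_delta_sq_eq \<beta>_def[symmetric] using b1 by (simp add: field_simps)
    then have "exp (- (\<sigma> * x)\<^sup>2 / 2) * exp (- mercer_delta_sq l * (\<sigma> * x)\<^sup>2) = exp (- x\<^sup>2 / 2)"
      unfolding exp_add[symmetric] by (rule arg_cong)
    moreover have "std_normal_density (\<sigma> * x) * mercer_phi l n (\<sigma> * x) = sqrt (\<beta> / fact n) * (1 / sqrt (2 * pi)
        * (exp (- (\<sigma> * x)\<^sup>2 / 2) * exp (- mercer_delta_sq l * (\<sigma> * x)\<^sup>2)) * herm n (\<beta> * (\<sigma> * x)))"
      unfolding std_normal_density_def mercer_phi_eq \<beta>_def by (simp only: mult_ac)
    ultimately show ?thesis by (simp add: std_normal_density_def mult.assoc)
  qed
  have "(\<integral>x. mercer_phi l n x \<partial>std_normal_distribution) = (\<integral>x. std_normal_density x * mercer_phi l n x \<partial>lborel)"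
    by (subst integral_density) (auto simp: normal_density_nonneg)
  also have "\<dots> = \<sigma> * (\<integral>x. std_normal_density (\<sigma> * x) * mercer_phi l n (\<sigma> * x) \<partial>lborel)"
    using lborel_integral_real_affine[of \<sigma> "\<lambda>x. std_normal_density x * mercer_phi l n x" 0] \<sigma>(1) by simp
  also have "\<dots> = \<sigma> * sqrt (\<beta> / fact n) * (\<integral>x. std_normal_density x * herm n (\<beta> * \<sigma> * x) \<partial>lborel)"
    unfolding dens by simp
  also have "(\<integral>x. std_normal_density x * herm n (\<beta> * \<sigma> * x) \<partial>lborel)
      = (\<integral>x. herm n (\<beta> * \<sigma> * x) \<partial>std_normal_distribution)"
    by (subst integral_density) (auto simp: normal_density_nonneg)
  finally have "(\<integral>x. mercer_phi l n x \<partial>std_normal_distribution)\<^sup>2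
      = (\<sigma> * sqrt (\<beta> / fact n))\<^sup>2 * (\<integral>x. herm n (\<beta> * \<sigma> * x) \<partial>std_normal_distribution)\<^sup>2"
    by (simp only: power_mult_distrib)
  also have "\<dots> \<le> (\<sigma> * sqrt (\<beta> / fact n))\<^sup>2 * (fact n * mercer_lambda l ^ n)"
  proof (intro mult_left_mono)
    have "(\<beta> * \<sigma>)\<^sup>2 - 1 = mercer_lambda l"
      unfolding power_mult_distrib \<sigma>(2) \<tau>_def mercer_tau_eq mercer_lambda_eq \<beta>_def[symmetric]
      by (simp add: field_simps add_nonneg_eq_0_iff)
    then show "(\<integral>x. herm n (\<beta> * \<sigma> * x) \<partial>std_normal_distribution)\<^sup>2 \<le> fact n * mercer_lambda l ^ n"
      using std_normal_herm_mean_bound[of "\<beta> * \<sigma>" n] mercer_lambda_bounds by simp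
  qed auto
  also have "(\<sigma> * sqrt (\<beta> / fact n))\<^sup>2 = \<tau> * (\<beta> / fact n)"
    using \<beta> by (simp add: power_mult_distrib \<sigma>(2))
  finally show ?thesis by (simp add: \<beta>_def \<tau>_def)
qed

lemma mercer_beta_inverse_sq: "0 < 1 / (mercer_beta l)\<^sup>2" "1 / (mercer_beta l)\<^sup>2 < 1"
  and mercer_lambda_inverse_beta_sq:
    "mercer_lambda l = (1 - 1 / (mercer_beta l)\<^sup>2) / (1 + 1 / (mercer_beta l)\<^sup>2)"
proof -
  define b where "b = (mercer_beta l)\<^sup>2"
  have b: "b > 1" unfolding b_def by (rule mercer_beta_sq_gt_1)
  then show "0 < 1 / (mercer_beta l)\<^sup>2" "1 / (mercer_beta l)\<^sup>2 < 1" by (auto simp flip: b_def)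
  have "b * (1 - 1 / b) = b - 1" "b * (1 + 1 / b) = b + 1" using b by (auto simp: field_simps)
  then have "(b - 1) / (b + 1) = (b * (1 - 1 / b)) / (b * (1 + 1 / b))" by simp
  also have "\<dots> = (1 - 1 / b) / (1 + 1 / b)" using b by (intro mult_divide_mult_cancel_left) auto
  finally show "mercer_lambda l = (1 - 1 / (mercer_beta l)\<^sup>2) / (1 + 1 / (mercer_beta l)\<^sup>2)"
    unfolding mercer_lambda_eq b_def[symmetric] .
qed

lemma mercer_rate_sq: "(mercer_rate l)\<^sup>2 = mercer_lambda l * exp (2 / (mercer_beta l)\<^sup>2)"
  using mercer_lambda_bounds by (simp add: mercer_rate_def power_mult_distrib flip: exp_double)

text \<open>With t = 1/\<beta>^2 the squared rate is (1 - t) exp(2t) / (1 + t), and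
  \<open>exp_double_less\<close> puts it below 1.\<close>

lemma mercer_rate_bounds: "0 < mercer_rate l" "mercer_rate l < 1" "sqrt (mercer_lambda l) \<le> mercer_rate l"
proof -
  show "0 < mercer_rate l" using mercer_lambda_bounds by (simp add: mercer_rate_def)
  show "sqrt (mercer_lambda l) \<le> mercer_rate l"
    using mercer_lambda_bounds by (simp add: mercer_rate_def mult_le_cancel_left1)
  define t where "t = 1 / (mercer_beta l)\<^sup>2"
  have t: "0 < t" "t < 1" unfolding t_def by (rule mercer_beta_inverse_sq)+
  have "mercer_lambda l = (1 - t) / (1 + t)"
    unfolding t_def by (rule mercer_lambda_inverse_beta_sq)
  then have "(mercer_rate l)\<^sup>2 = (1 - t) * exp (2 * t) / (1 + t)"
    by (simp add: mercer_rate_sq t_def)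
  also have "\<dots> < 1" using exp_double_less[OF t(1)] t by simp
  finally show "mercer_rate l < 1" using power2_less_imp_less[of "mercer_rate l" 1] by simp
qed

text \<open>The purpose is \<open>mercer_const_ge_1\<close>. For t = 1/\<beta>^2, exp t \<ge> 1 + t
  gives \<eta> \<ge> \<eta>^2 \<ge> 1 - t^2, hence 1 - \<eta> \<le> t^2 \<le> t, while t^2 \<le> t
  \<le> \<tau> \<le> \<tau> \<beta>.\<close>

lemma one_minus_mercer_rate_le: "1 - mercer_rate l \<le> sqrt (mercer_tau l * mercer_beta l)"
proof -
  define t where "t = 1 / (mercer_beta l)\<^sup>2"
  have t: "0 < t" "t < 1" unfolding t_def by (rule mercer_beta_inverse_sq)+
  have lam: "mercer_lambda l = (1 - t) / (1 + t)"
    unfolding t_def by (rule mercer_lambda_inverse_beta_sq)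
  have "(1 + t)\<^sup>2 \<le> (exp t)\<^sup>2" using t by (intro power_mono exp_ge_add_one_self) auto
  then have "(1 + t)\<^sup>2 \<le> exp (2 * t)" by (simp add: exp_double)
  then have "(1 - t) / (1 + t) * (1 + t)\<^sup>2 \<le> (mercer_rate l)\<^sup>2"
    using t by (simp add: mercer_rate_sq lam t_def divide_right_mono)
  also have "(1 - t) / (1 + t) * (1 + t)\<^sup>2 = 1 - t\<^sup>2"
    using t by (simp add: power2_eq_square field_simps)
  also have "(mercer_rate l)\<^sup>2 \<le> mercer_rate l"
    using mercer_rate_bounds by (simp add: power2_eq_square mult_le_cancel_left1)
  finally have "1 - mercer_rate l \<le> t\<^sup>2" by simp
  also have "t\<^sup>2 \<le> t" using t by (simp add: power2_eq_square mult_le_cancel_left1)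
  also have "t \<le> sqrt (mercer_tau l * mercer_beta l)"
  proof (rule real_le_rsqrt)
    have "t\<^sup>2 \<le> t" using t by (simp add: power2_eq_square mult_le_cancel_left1)
    also have "t = 2 / ((mercer_beta l)\<^sup>2 + (mercer_beta l)\<^sup>2)" by (simp add: t_def)
    also have "\<dots> \<le> 2 / ((mercer_beta l)\<^sup>2 + 1)"
      using mercer_beta_sq_gt_1 by (intro divide_left_mono mult_pos_pos add_pos_pos) auto
    also have "\<dots> = mercer_tau l * 1" by (simp add: mercer_tau_eq)
    also have "\<dots> \<le> mercer_tau l * mercer_beta l"
      using mercer_tau_bounds mercer_beta_gt_1 by (intro mult_left_mono) auto
    finally show "t\<^sup>2 \<le> mercer_tau l * mercer_beta l" .
  qed
  finally show ?thesis .
qed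

end

subsection \<open>Quadrature in one dimension\<close>

text \<open>Cauchy-Schwarz controls every partial sum and not just the limit; this supplies the
  constant dominating function for integrating the Mercer series term by term.\<close>

lemma abs_sum_mult_le_1:
  fixes a b :: "nat \<Rightarrow> real"
  assumes "(\<lambda>n. a n * a n) sums 1" "(\<lambda>n. b n * b n) sums 1"
  shows "\<bar>\<Sum>n<m. a n * b n\<bar> \<le> 1"
proof -
  have "(\<Sum>n<m. (a n)\<^sup>2) \<le> 1" "(\<Sum>n<m. (b n)\<^sup>2) \<le> 1"
    using sum_le_suminf[of "\<lambda>n. a n * a n" "{..<m}"] sum_le_suminf[of "\<lambda>n. b n * b n" "{..<m}"] assms
    by (auto simp: sums_iff power2_eq_square)
  then have "(\<Sum>n<m. a n * b n)\<^sup>2 \<le> 1 * 1"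
    by (intro order_trans[OF Cauchy_Schwarz_ineq_sum] mult_mono sum_nonneg) auto
  then show ?thesis by (simp add: abs_square_le_1)
qed

lemma sums_Cauchy_Schwarz:
  fixes a b :: "nat \<Rightarrow> real"
  assumes "(\<lambda>n. a n * a n) sums A" "(\<lambda>n. a n * b n) sums B" "(\<lambda>n. b n * b n) sums D"
  shows "B\<^sup>2 \<le> A * D"
proof (rule LIMSEQ_le)
  show "(\<lambda>m. (\<Sum>n<m. a n * b n)\<^sup>2) \<longlonglongrightarrow> B\<^sup>2"
    using assms(2) unfolding sums_def by (intro tendsto_intros)
  show "(\<lambda>m. (\<Sum>n<m. a n * a n) * (\<Sum>n<m. b n * b n)) \<longlonglongrightarrow> A * D"
    using assms(1,3) unfolding sums_def by (intro tendsto_intros)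
  show "\<exists>N. \<forall>m\<ge>N. (\<Sum>n<m. a n * b n)\<^sup>2 \<le> (\<Sum>n<m. a n * a n) * (\<Sum>n<m. b n * b n)"
    using Cauchy_Schwarz_ineq_sum[of a b] by (auto simp: power2_eq_square)
qed

lemma sums_geometric_tail_le:
  fixes r :: real
  assumes "f sums S" "0 < r" "r < 1" "\<And>n. n < M \<Longrightarrow> f n = 0" "\<And>n. n \<ge> M \<Longrightarrow> f n \<le> c * r ^ n"
  shows "S \<le> c * r ^ M / (1 - r)"
proof -
  have "(\<lambda>n. f (n + M)) sums S"
    using sums_split_initial_segment[OF assms(1), of M] assms(4) by simp
  moreover have "(\<lambda>n. c * r ^ M * r ^ n) sums (c * r ^ M * (1 / (1 - r)))"
    using assms by (intro sums_mult geometric_sums) auto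
  ultimately have "S \<le> c * r ^ M * (1 / (1 - r))"
    by (rule sums_le[rotated]) (use assms(5)[of "n + M" for n] in \<open>simp add: power_add mult_ac\<close>)
  then show ?thesis by simp
qed

lemma gauss_kernel1_bounds: "0 < gauss_kernel1 l x y" "gauss_kernel1 l x y \<le> 1" "gauss_kernel1 l x x = 1"
  by (auto simp: gauss_kernel1_def)

lemma borel_measurable_gauss_kernel1 [measurable]:
  assumes "f \<in> borel_measurable N" "g \<in> borel_measurable N"
  shows "(\<lambda>x. gauss_kernel1 l (f x) (g x)) \<in> borel_measurable N"
  using assms unfolding gauss_kernel1_def by measurable

text \<open>The base of the d-th power in C, for a single length-scale.\<close>

definition mercer_const :: "real \<Rightarrow> real" where
  "mercer_const l = 1.087 * sqrt (mercer_tau l * mercer_beta l) / (1 - mercer_rate l)"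

lemma mercer_const_ge_1: "l > 0 \<Longrightarrow> mercer_const l \<ge> 1"
  using one_minus_mercer_rate_le[of l] mercer_rate_bounds[of l] by (simp add: mercer_const_def field_simps)

locale gauss_quadrature =
  fixes l W :: real and N M :: nat and x w :: "nat \<Rightarrow> real"
  assumes l: "l > 0" and W: "W \<ge> 1" and weights: "(\<Sum>n=1..N. \<bar>w n\<bar>) \<le> W" and M: "M \<ge> 1"
    and exact: "\<And>n. n < M \<Longrightarrow> quadrature N x w (mercer_phi l n)
          = (\<integral>t. mercer_phi l n t \<partial>std_normal_distribution)"
    and nodes: "\<And>n. n \<in> {1..N} \<Longrightarrow> \<bar>x n\<bar> \<le> 2 * sqrt (real M) / mercer_beta l"
begin

text \<open>\<open>mu_mu\<close>, \<open>mu_Q\<close> and \<open>Q_Q\<close> are A, B and D for one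
  coordinate: the Gram entries of the kernel embeddings of \<mu> and Q, written without reference to
  any Hilbert space.\<close>

definition mu_mu :: real where
  "mu_mu = (\<integral>t. \<integral>s. gauss_kernel1 l t s \<partial>std_normal_distribution \<partial>std_normal_distribution)"

definition mu_Q :: real where
  "mu_Q = (\<Sum>n=1..N. w n * (\<integral>s. gauss_kernel1 l (x n) s \<partial>std_normal_distribution))"

definition Q_Q :: real where
  "Q_Q = (\<Sum>n=1..N. w n * (\<Sum>m=1..N. w m * gauss_kernel1 l (x n) (x m)))"

text \<open>The n-th coordinate of the feature map into square-summable sequences.
  \<open>mu_feature\<close> and \<open>Q_feature\<close> are then the coordinates of the embedded
  \<mu> and Q.\<close>

definition feature :: "nat \<Rightarrow> real \<Rightarrow> real" where
  "feature n t = sqrt (mercer_tau l * mercer_lambda l ^ n) * mercer_phi l n t"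

definition mu_feature :: "nat \<Rightarrow> real" where
  "mu_feature n = (\<integral>t. feature n t \<partial>std_normal_distribution)"

definition Q_feature :: "nat \<Rightarrow> real" where
  "Q_feature n = (\<Sum>i=1..N. w i * feature n (x i))"

sublocale real_distribution std_normal_distribution
  by (rule real_dist_normal_dist)

lemma prob_UNIV: "prob UNIV = 1"
  using prob_space by simp

lemma feature_measurable [measurable]: "feature n \<in> borel_measurable borel"
  unfolding feature_def[abs_def] using l by measurable

lemma feature_sums: "(\<lambda>n. feature n s * feature n t) sums gauss_kernel1 l s t"
proof -
  have "feature n s * feature n t
      = (sqrt (mercer_tau l * mercer_lambda l ^ n) * sqrt (mercer_tau l * mercer_lambda l ^ n))
        * (mercer_phi l n s * mercer_phi l n t)" for n
    unfolding feature_def by (simp only: mult_ac)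
  then have "feature n s * feature n t = mercer_tau l * mercer_lambda l ^ n * (mercer_phi l n s * mercer_phi l n t)" for n
    using mercer_tau_bounds[OF l] mercer_lambda_bounds[OF l] by simp
  then show ?thesis using mercer_expansion[OF l, of s t] by simp
qed

lemma feature_partial: "\<bar>\<Sum>n<m. feature n s * feature n t\<bar> \<le> 1"
  by (rule abs_sum_mult_le_1) (use feature_sums[of s s] feature_sums[of t t] gauss_kernel1_bounds(3) in auto)

text \<open>A single term of a series of squares whose sum is the kernel on the diagonal, which is
  1. Integrability of each feature follows with no growth estimate.\<close>

lemma feature_le_1: "\<bar>feature n t\<bar> \<le> 1"
proof -
  have "(feature n t)\<^sup>2 \<le> (\<Sum>i<Suc n. feature i t * feature i t)"
    by (simp add: sum_nonneg power2_eq_square)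
  also have "\<dots> \<le> 1" using feature_partial[where m = "Suc n" and s = t and t = t] by linarith
  finally show ?thesis by (simp add: abs_square_le_1)
qed

lemma feature_integrable: "integrable std_normal_distribution (feature n)"
  by (rule integrable_const_bound[of _ 1]) (use feature_le_1 in auto)

lemma integral_feature_partial:
  "(\<integral>t. (\<Sum>n<m. feature n s * feature n t) \<partial>std_normal_distribution) = (\<Sum>n<m. feature n s * mu_feature n)"
  by (simp add: feature_integrable mu_feature_def)

lemma mu_feature_sums:
  "(\<lambda>n. feature n s * mu_feature n) sums (\<integral>t. gauss_kernel1 l s t \<partial>std_normal_distribution)"
  unfolding sums_def integral_feature_partial[symmetric]
  by (rule integral_dominated_convergence[where w = "\<lambda>_. 1"])
     (use feature_sums feature_partial in \<open>auto simp: sums_def\<close>)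

lemma mu_feature_partial: "\<bar>\<Sum>n<m. feature n s * mu_feature n\<bar> \<le> 1"
proof -
  have "norm (\<integral>t. (\<Sum>n<m. feature n s * feature n t) \<partial>std_normal_distribution)
      \<le> (\<integral>t. 1 \<partial>std_normal_distribution)"
    by (rule Bochner_Integration.integral_norm_bound_integral)
       (use feature_partial in \<open>auto intro!: feature_integrable Bochner_Integration.integrable_sum integrable_mult_right\<close>)
  then show ?thesis by (simp add: integral_feature_partial prob_UNIV)
qed

lemma mu_mu_sums: "(\<lambda>n. mu_feature n * mu_feature n) sums mu_mu"
proof -
  have "(\<lambda>m. \<integral>t. (\<Sum>n<m. feature n t * mu_feature n) \<partial>std_normal_distribution) \<longlonglongrightarrow> mu_mu"
    unfolding mu_mu_def
    by (rule integral_dominated_convergence[where w = "\<lambda>_. 1"])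
       (use mu_feature_sums mu_feature_partial in \<open>auto simp: sums_def\<close>)
  moreover have "(\<integral>t. (\<Sum>n<m. feature n t * mu_feature n) \<partial>std_normal_distribution)
      = (\<Sum>n<m. mu_feature n * mu_feature n)" for m
    by (simp add: feature_integrable mu_feature_def)
  ultimately show ?thesis by (simp add: sums_def)
qed

lemma mu_Q_sums: "(\<lambda>n. mu_feature n * Q_feature n) sums mu_Q"
proof -
  have "(\<lambda>n. \<Sum>i=1..N. w i * (feature n (x i) * mu_feature n)) sums mu_Q"
    unfolding mu_Q_def by (intro sums_sum sums_mult mu_feature_sums)
  then show ?thesis by (simp add: Q_feature_def sum_distrib_left mult_ac)
qed

lemma Q_Q_sums: "(\<lambda>n. Q_feature n * Q_feature n) sums Q_Q"
proof -
  have "(\<lambda>n. \<Sum>i=1..N. w i * (\<Sum>j=1..N. w j * (feature n (x i) * feature n (x j)))) sums Q_Q"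
    unfolding Q_Q_def by (intro sums_sum sums_mult feature_sums)
  moreover have "(\<Sum>i=1..N. w i * (\<Sum>j=1..N. w j * (feature n (x i) * feature n (x j))))
      = Q_feature n * Q_feature n" for n
    unfolding Q_feature_def sum_product by (simp add: sum_distrib_left mult_ac)
  ultimately show ?thesis by simp
qed

lemma gram_Cauchy_Schwarz: "mu_Q\<^sup>2 \<le> mu_mu * Q_Q"
  by (rule sums_Cauchy_Schwarz[OF mu_mu_sums mu_Q_sums Q_Q_sums])

lemma mu_mu_nonneg: "0 \<le> mu_mu"
  by (rule sums_le[OF _ sums_zero mu_mu_sums]) simp

lemma Q_Q_nonneg: "0 \<le> Q_Q"
  by (rule sums_le[OF _ sums_zero Q_Q_sums]) simp

lemma mu_mu_le_1: "mu_mu \<le> 1"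
proof -
  have "\<bar>\<integral>s. gauss_kernel1 l t s \<partial>std_normal_distribution\<bar> \<le> 1" for t
    using LIMSEQ_le_const2[OF tendsto_rabs[OF mu_feature_sums[of t, unfolded sums_def]], of 1] mu_feature_partial
    by auto
  then have "norm mu_mu \<le> (\<integral>t. 1 \<partial>std_normal_distribution)"
    unfolding mu_mu_def
    by (intro Bochner_Integration.integral_norm_bound_integral integrable_const_bound[of _ 1]) auto
  then show ?thesis by (simp add: prob_UNIV)
qed

lemma Q_Q_le: "Q_Q \<le> W\<^sup>2"
proof -
  have "Q_Q \<le> (\<Sum>n=1..N. \<bar>w n\<bar> * (\<Sum>m=1..N. \<bar>w m\<bar> * 1))"
    unfolding Q_Q_def
  proof (rule sum_mono)
    fix n
    have "w n * (\<Sum>m=1..N. w m * gauss_kernel1 l (x n) (x m))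
        \<le> \<bar>w n\<bar> * \<bar>\<Sum>m=1..N. w m * gauss_kernel1 l (x n) (x m)\<bar>"
      by (metis abs_ge_self abs_mult)
    also have "\<dots> \<le> \<bar>w n\<bar> * (\<Sum>m=1..N. \<bar>w m * gauss_kernel1 l (x n) (x m)\<bar>)"
      by (intro mult_left_mono sum_abs) auto
    also have "\<dots> \<le> \<bar>w n\<bar> * (\<Sum>m=1..N. \<bar>w m\<bar> * 1)"
      unfolding abs_mult using gauss_kernel1_bounds[of l]
      by (intro mult_left_mono sum_mono) (auto simp: less_imp_le)
    finally show "w n * (\<Sum>m=1..N. w m * gauss_kernel1 l (x n) (x m))
        \<le> \<bar>w n\<bar> * (\<Sum>m=1..N. \<bar>w m\<bar> * 1)" .
  qed
  also have "\<dots> = (\<Sum>n=1..N. \<bar>w n\<bar>)\<^sup>2"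
    by (simp add: power2_eq_square sum_distrib_right)
  also have "\<dots> \<le> W\<^sup>2" by (intro power_mono weights sum_nonneg) auto
  finally show ?thesis .
qed

lemma error_sums: "(\<lambda>n. (mu_feature n - Q_feature n)\<^sup>2) sums (mu_mu - 2 * mu_Q + Q_Q)"
  using sums_add[OF sums_diff[OF mu_mu_sums sums_mult[OF mu_Q_sums, of 2]] Q_Q_sums]
  by (simp add: power2_eq_square algebra_simps)

lemma mu_feature_eq: "mu_feature n
    = sqrt (mercer_tau l * mercer_lambda l ^ n) * (\<integral>t. mercer_phi l n t \<partial>std_normal_distribution)"
  by (simp add: mu_feature_def feature_def)

lemma Q_feature_eq: "Q_feature n
    = sqrt (mercer_tau l * mercer_lambda l ^ n) * quadrature N x w (mercer_phi l n)"
  by (simp add: Q_feature_def feature_def quadrature_def sum_distrib_left mult_ac)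

lemma feature_error_zero: "n < M \<Longrightarrow> mu_feature n = Q_feature n"
  by (simp add: mu_feature_eq Q_feature_eq exact)

lemma feature_error_bound:
  assumes "n \<ge> M"
  shows "\<bar>mu_feature n - Q_feature n\<bar>
    \<le> sqrt (mercer_tau l * mercer_beta l) * W * (2.16 + mercer_rate l) * mercer_rate l ^ n"
proof -
  define \<beta> \<tau> s \<eta> where "\<beta> = mercer_beta l" and "\<tau> = mercer_tau l" and "s = sqrt (mercer_lambda l)"
    and "\<eta> = mercer_rate l"
  have \<beta>: "\<beta> > 1" using mercer_beta_gt_1[OF l] by (auto simp: \<beta>_def)
  have \<tau>: "0 < \<tau>" "\<tau> < 1" using mercer_tau_bounds[OF l] by (auto simp: \<tau>_def)
  have \<eta>: "0 < \<eta>" "\<eta> < 1" "s \<le> \<eta>" using mercer_rate_bounds[OF l] by (auto simp: \<eta>_def s_def)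
  have s: "0 < s" "s\<^sup>2 = mercer_lambda l" using mercer_lambda_bounds[OF l] by (auto simp: s_def)
  have sq: "sqrt (mercer_tau l * mercer_lambda l ^ n) = sqrt \<tau> * s ^ n"
    using s by (simp add: real_sqrt_mult \<tau>_def s_def real_sqrt_power)
  have "\<bar>mu_feature n\<bar> \<le> sqrt (\<tau> * \<beta>) * (\<eta> ^ n * \<eta>)"
  proof -
    have "\<bar>\<integral>t. mercer_phi l n t \<partial>std_normal_distribution\<bar> \<le> sqrt (\<tau> * \<beta> * mercer_lambda l ^ n)"
      using mercer_phi_mean_bound[OF l, of n] by (intro real_le_rsqrt) (simp add: \<tau>_def \<beta>_def)
    also have "\<dots> = sqrt (\<tau> * \<beta>) * s ^ n" by (simp add: real_sqrt_mult s_def real_sqrt_power)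
    finally have "\<bar>mu_feature n\<bar> \<le> (sqrt \<tau> * s ^ n) * (sqrt (\<tau> * \<beta>) * s ^ n)"
      unfolding mu_feature_eq sq abs_mult using \<tau> s by (intro mult_mono) auto
    also have "\<dots> \<le> (1 * \<eta> ^ n) * (sqrt (\<tau> * \<beta>) * \<eta> ^ n)"
      using \<tau> s \<eta> \<beta> by (intro mult_mono power_mono) auto
    \<comment> \<open>Since n \<ge> M \<ge> 1, the second power of \<eta> still yields one factor
      \<eta>. It turns 2.16 + 1 into 2.16 + \<eta>; with 3.16 the comparison in
      \<open>gram_error\<close> would fail for small \<eta>.\<close>
    also have "\<dots> \<le> (1 * \<eta> ^ n) * (sqrt (\<tau> * \<beta>) * \<eta> ^ 1)"
      using \<tau> \<eta> \<beta> assms M by (intro mult_left_mono power_decreasing) auto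
    finally show ?thesis by (simp add: mult_ac)
  qed
  moreover have "\<bar>Q_feature n\<bar> \<le> sqrt (\<tau> * \<beta>) * W * (2.16 * \<eta> ^ n)"
  proof -
    have node: "\<bar>mercer_phi l n (x i)\<bar> \<le> 2.16 * sqrt \<beta> * exp (real n * (1 / \<beta>\<^sup>2))" if "i \<in> {1..N}" for i
    proof -
      \<comment> \<open>The node condition has exactly this use: x^2/4 \<le> M/\<beta>^2 \<le>
        n/\<beta>^2 turns the growth factor into the n-th power of exp(1/\<beta>^2), which joins s^n
        to form \<eta>^n.\<close>
      have "\<bar>x i\<bar>\<^sup>2 \<le> (2 * sqrt (real M) / \<beta>)\<^sup>2"
        using nodes[OF that] by (intro power_mono) (auto simp: \<beta>_def)
      then have "(x i)\<^sup>2 / 4 \<le> real M * (1 / \<beta>\<^sup>2)"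
        by (simp add: power_mult_distrib power_divide mult.commute)
      also have "\<dots> \<le> real n * (1 / \<beta>\<^sup>2)" using assms by (intro mult_right_mono) auto
      finally have "exp ((x i)\<^sup>2 / 4) \<le> exp (real n * (1 / \<beta>\<^sup>2))" by simp
      then have "2.16 * sqrt \<beta> * exp ((x i)\<^sup>2 / 4) \<le> 2.16 * sqrt \<beta> * exp (real n * (1 / \<beta>\<^sup>2))"
        using \<beta> by (intro mult_left_mono) auto
      then show ?thesis using mercer_phi_bound[OF l, of n "x i"] unfolding \<beta>_def by linarith
    qed
    have "\<bar>quadrature N x w (mercer_phi l n)\<bar> \<le> (\<Sum>i=1..N. \<bar>w i\<bar> * (2.16 * sqrt \<beta> * exp (real n * (1 / \<beta>\<^sup>2))))"
      unfolding quadrature_def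
    proof (intro order_trans[OF sum_abs] sum_mono)
      fix i assume "i \<in> {1..N}"
      then show "\<bar>w i * mercer_phi l n (x i)\<bar> \<le> \<bar>w i\<bar> * (2.16 * sqrt \<beta> * exp (real n * (1 / \<beta>\<^sup>2)))"
        unfolding abs_mult by (intro mult_left_mono node) auto
    qed
    also have "\<dots> = (\<Sum>i=1..N. \<bar>w i\<bar>) * (2.16 * sqrt \<beta> * exp (real n * (1 / \<beta>\<^sup>2)))"
      by (rule sum_distrib_right[symmetric])
    also have "\<dots> \<le> W * (2.16 * sqrt \<beta> * exp (real n * (1 / \<beta>\<^sup>2)))"
      using \<beta> by (intro mult_right_mono weights) auto
    finally have "\<bar>Q_feature n\<bar> \<le> (sqrt \<tau> * s ^ n) * (W * (2.16 * sqrt \<beta> * exp (real n * (1 / \<beta>\<^sup>2))))"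
      unfolding Q_feature_eq sq abs_mult using \<tau> s by (intro mult_mono) auto
    also have "exp (real n * (1 / \<beta>\<^sup>2)) = exp (1 / \<beta>\<^sup>2) ^ n" by (rule exp_of_nat_mult)
    also have "(sqrt \<tau> * s ^ n) * (W * (2.16 * sqrt \<beta> * exp (1 / \<beta>\<^sup>2) ^ n))
        = sqrt (\<tau> * \<beta>) * W * (2.16 * (s * exp (1 / \<beta>\<^sup>2)) ^ n)"
      by (simp add: real_sqrt_mult power_mult_distrib)
    finally show ?thesis by (simp add: \<eta>_def mercer_rate_def s_def \<beta>_def)
  qed
  moreover have "sqrt (\<tau> * \<beta>) * 1 * (\<eta> ^ n * \<eta>) \<le> sqrt (\<tau> * \<beta>) * W * (\<eta> ^ n * \<eta>)"
    using \<tau> \<beta> \<eta> W by (intro mult_right_mono mult_left_mono) auto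
  ultimately have "\<bar>mu_feature n - Q_feature n\<bar>
      \<le> sqrt (\<tau> * \<beta>) * W * (\<eta> ^ n * \<eta>) + sqrt (\<tau> * \<beta>) * W * (2.16 * \<eta> ^ n)" by linarith
  also have "\<dots> = sqrt (\<tau> * \<beta>) * W * (2.16 + \<eta>) * \<eta> ^ n" by (simp add: algebra_simps)
  finally show ?thesis by (simp add: \<tau>_def \<beta>_def \<eta>_def)
qed

lemma gram_error: "mu_mu - 2 * mu_Q + Q_Q \<le> (W * (2 * mercer_const l * mercer_rate l ^ M))\<^sup>2"
proof -
  define \<eta> where "\<eta> = mercer_rate l"
  define u where "u = sqrt (mercer_tau l * mercer_beta l) * W"
  have \<eta>: "0 < \<eta>" "\<eta> < 1" using mercer_rate_bounds[OF l] by (auto simp: \<eta>_def)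
  have "mu_mu - 2 * mu_Q + Q_Q \<le> (u * (2.16 + \<eta>))\<^sup>2 * (\<eta>\<^sup>2) ^ M / (1 - \<eta>\<^sup>2)"
  proof (rule sums_geometric_tail_le[OF error_sums])
    show "(mu_feature n - Q_feature n)\<^sup>2 \<le> (u * (2.16 + \<eta>))\<^sup>2 * (\<eta>\<^sup>2) ^ n" if "n \<ge> M" for n
    proof -
      have "\<bar>mu_feature n - Q_feature n\<bar>\<^sup>2 \<le> (u * (2.16 + \<eta>) * \<eta> ^ n)\<^sup>2"
        using feature_error_bound[OF that] by (intro power_mono) (auto simp: u_def \<eta>_def)
      then show ?thesis by (simp add: power_mult_distrib power_mult[symmetric] mult.commute[of n])
    qed
  qed (use \<eta> feature_error_zero in \<open>auto simp: abs_square_less_1\<close>)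
  also have "\<dots> = (u * \<eta> ^ M)\<^sup>2 * ((2.16 + \<eta>)\<^sup>2 / (1 - \<eta>\<^sup>2))"
    by (simp add: power_mult_distrib power_mult[symmetric] mult.commute[of M])
  also have "\<dots> \<le> (u * \<eta> ^ M)\<^sup>2 * ((2 * 1.087)\<^sup>2 / (1 - \<eta>)\<^sup>2)"
  proof (intro mult_left_mono)
    \<comment> \<open>Squares sum to 1/(1 - \<eta>^2) while the target has 1/(1 - \<eta>)^2; the
      spare factor (1 - \<eta>)/(1 + \<eta>) outweighs the growth of (2.16 + \<eta>)^2, as all
      powers of \<eta> in the expansion carry a minus sign. Only 2.16 \<le> 2 * 1.087 remains to be
      checked.\<close>
    have "(2.16 + \<eta>)\<^sup>2 * (1 - \<eta>) = 4.6656 - (0.3456 * \<eta> + 3.32 * \<eta>\<^sup>2 + \<eta> ^ 3)"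
      by (simp add: power2_eq_square power3_eq_cube field_simps)
    also have "\<dots> \<le> (2 * 1.087)\<^sup>2 * (1 + \<eta>)"
    proof -
      have "0.3456 * \<eta> + 3.32 * \<eta>\<^sup>2 + \<eta> ^ 3 \<ge> 0" using \<eta> by simp
      moreover have "(2 * 1.087)\<^sup>2 * (1 + \<eta>) \<ge> (2 * 1.087)\<^sup>2 * 1" using \<eta> by (intro mult_left_mono) auto
      moreover have "4.6656 \<le> (2 * 1.087)\<^sup>2 * (1::real)" by (simp add: power2_eq_square)
      ultimately show ?thesis by linarith
    qed
    finally have "(2.16 + \<eta>)\<^sup>2 * (1 - \<eta>) / ((1 - \<eta>) * (1 - \<eta>) * (1 + \<eta>))
        \<le> (2 * 1.087)\<^sup>2 * (1 + \<eta>) / ((1 - \<eta>) * (1 - \<eta>) * (1 + \<eta>))"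
      using \<eta> by (intro divide_right_mono) auto
    moreover have "(2.16 + \<eta>)\<^sup>2 * (1 - \<eta>) / ((1 - \<eta>) * (1 - \<eta>) * (1 + \<eta>)) = (2.16 + \<eta>)\<^sup>2 / (1 - \<eta>\<^sup>2)"
    proof -
      have "(1 - \<eta>) * (1 - \<eta>) * (1 + \<eta>) = (1 - \<eta>\<^sup>2) * (1 - \<eta>)"
        by (simp add: power2_eq_square algebra_simps)
      then show ?thesis using \<eta> by simp
    qed
    moreover have "(2 * 1.087)\<^sup>2 * (1 + \<eta>) / ((1 - \<eta>) * (1 - \<eta>) * (1 + \<eta>)) = (2 * 1.087)\<^sup>2 / (1 - \<eta>)\<^sup>2"
      using \<eta> unfolding power2_eq_square[of "1 - \<eta>"] by (intro mult_divide_mult_cancel_right) auto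
    ultimately show "(2.16 + \<eta>)\<^sup>2 / (1 - \<eta>\<^sup>2) \<le> (2 * 1.087)\<^sup>2 / (1 - \<eta>)\<^sup>2" by linarith
  qed auto
  also have "\<dots> = (u * \<eta> ^ M * (2 * 1.087 / (1 - \<eta>)))\<^sup>2"
    by (simp only: power_mult_distrib power_divide)
  also have "u * \<eta> ^ M * (2 * 1.087 / (1 - \<eta>)) = W * (2 * mercer_const l * mercer_rate l ^ M)"
    by (simp only: u_def mercer_const_def \<eta>_def times_divide_eq_left times_divide_eq_right mult_ac)
  finally show ?thesis .
qed

end

subsection \<open>Positive semidefinite kernels and Gram entries of tensor products\<close>

text \<open>If the double integral were \<open>-a < 0\<close>, then choosing points one at a time, each no worse than
  the average, would produce points whose Gram sum is at most \<open>n B - a n (n - 1)\<close>.\<close>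

lemma (in prob_space) psd_double_integral_nonneg:
  fixes P :: "'a \<Rightarrow> 'a \<Rightarrow> real"
  assumes int: "\<And>x. integrable M (P x)" and diag: "integrable M (\<lambda>x. P x x)"
    and int2: "integrable M (\<lambda>x. \<integral>y. P x y \<partial>M)"
    and sym: "\<And>x y. P x y = P y x"
    and psd: "\<And>n (z :: nat \<Rightarrow> 'a). 0 \<le> (\<Sum>i<n. \<Sum>j<n. P (z i) (z j))"
  shows "0 \<le> (\<integral>x. \<integral>y. P x y \<partial>M \<partial>M)"
proof (rule ccontr)
  define u where "u x = (\<integral>y. P x y \<partial>M)" for x
  define a B where "a = - (\<integral>x. u x \<partial>M)" and "B = (\<integral>x. P x x \<partial>M)"
  assume "\<not> ?thesis"
  then have a: "a > 0" by (simp add: a_def u_def)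
  have choose: "\<exists>x. f x \<le> (\<integral>x. f x \<partial>M)" if "integrable M f" for f :: "'a \<Rightarrow> real"
  proof (rule ccontr)
    assume "\<not> ?thesis"
    then have *: "\<And>x. (\<integral>x. f x \<partial>M) < f x" by (simp add: not_le)
    have "(\<integral>x. (\<integral>x. f x \<partial>M) \<partial>M) < (\<integral>x. f x \<partial>M)"
      by (rule integral_less_AE_space) (use that * in \<open>auto simp: emeasure_space_1\<close>)
    then show False by (simp add: prob_space)
  qed
  \<comment> \<open>Here m counts points still to be chosen, and the term with \<open>u\<close> is
    their mean interaction with the chosen ones. Carrying it along lets each point be averaged
    alone, so that only iterated integrals occur and no n-fold product measure.\<close>
  have "\<exists>z. (\<Sum>i<n. \<Sum>j<n. P (z i) (z j)) + 2 * real m * (\<Sum>i<n. u (z i))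
      \<le> real n * B - a * (real n * (real n - 1) + 2 * real n * real m)" for n m
  proof (induction n arbitrary: m)
    case (Suc n)
    obtain z where z: "(\<Sum>i<n. \<Sum>j<n. P (z i) (z j)) + 2 * real (Suc m) * (\<Sum>i<n. u (z i))
        \<le> real n * B - a * (real n * (real n - 1) + 2 * real n * real (Suc m))"
      using Suc.IH by blast
    \<comment> \<open>The contribution that depends on the new point y, when n points are fixed and
      m remain.\<close>
    define f where "f y = 2 * (\<Sum>i<n. P (z i) y) + P y y + 2 * real m * u y" for y
    have int_f: "integrable M f"
      unfolding f_def u_def
      by (intro Bochner_Integration.integrable_add integrable_mult_right Bochner_Integration.integrable_sum int diag int2)
    have "(\<integral>y. f y \<partial>M) = 2 * (\<Sum>i<n. u (z i)) + B - 2 * real m * a"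
    proof -
      have "(\<integral>y. f y \<partial>M) = (\<integral>y. 2 * (\<Sum>i<n. P (z i) y) + P y y \<partial>M) + (\<integral>y. 2 * real m * u y \<partial>M)"
        unfolding f_def u_def
        by (intro Bochner_Integration.integral_add Bochner_Integration.integrable_add integrable_mult_right
            Bochner_Integration.integrable_sum int diag int2)
      also have "(\<integral>y. 2 * (\<Sum>i<n. P (z i) y) + P y y \<partial>M) = (\<integral>y. 2 * (\<Sum>i<n. P (z i) y) \<partial>M) + (\<integral>y. P y y \<partial>M)"
        by (intro Bochner_Integration.integral_add integrable_mult_right
            Bochner_Integration.integrable_sum int diag)
      finally show ?thesis
        by (simp add: int a_def B_def u_def)
    qed
    then obtain y where y: "f y \<le> 2 * (\<Sum>i<n. u (z i)) + B - 2 * real m * a"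
      using choose[OF int_f] by auto
    define z' where "z' = z(n := y)"
    have z': "z' n = y" "\<And>i. i < n \<Longrightarrow> z' i = z i" by (auto simp: z'_def)
    have "(\<Sum>j<n. P y (z j)) = (\<Sum>j<n. P (z j) y)" by (rule sum.cong[OF refl sym])
    then have "(\<Sum>i<Suc n. \<Sum>j<Suc n. P (z' i) (z' j))
        = (\<Sum>i<n. \<Sum>j<n. P (z i) (z j)) + 2 * (\<Sum>i<n. P (z i) y) + P y y"
      by (simp add: z' sum.distrib)
    moreover have "(\<Sum>i<Suc n. u (z' i)) = (\<Sum>i<n. u (z i)) + u y"
      by (simp add: z')
    ultimately have "(\<Sum>i<Suc n. \<Sum>j<Suc n. P (z' i) (z' j)) + 2 * real m * (\<Sum>i<Suc n. u (z' i))
        = ((\<Sum>i<n. \<Sum>j<n. P (z i) (z j)) + 2 * real (Suc m) * (\<Sum>i<n. u (z i)))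
          + (f y - 2 * (\<Sum>i<n. u (z i)))"
      by (simp add: f_def algebra_simps)
    also have "\<dots> \<le> real n * B - a * (real n * (real n - 1) + 2 * real n * real (Suc m)) + (B - 2 * real m * a)"
      using z y by linarith
    also have "\<dots> = real (Suc n) * B - a * (real (Suc n) * (real (Suc n) - 1) + 2 * real (Suc n) * real m)"
      by (simp add: algebra_simps)
    finally show ?case by blast
  qed auto
  then have avg: "\<exists>z. (\<Sum>i<n. \<Sum>j<n. P (z i) (z j)) + 2 * real m * (\<Sum>i<n. u (z i))
      \<le> real n * B - a * (real n * (real n - 1) + 2 * real n * real m)" for n m .
  have bound: "0 \<le> real n * B - a * (real n * (real n - 1))" for n
  proof -
    obtain z where "(\<Sum>i<n. \<Sum>j<n. P (z i) (z j)) \<le> real n * B - a * (real n * (real n - 1))"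
      using avg[of n 0] by auto
    moreover have "0 \<le> (\<Sum>i<n. \<Sum>j<n. P (z i) (z j))" by (rule psd)
    ultimately show ?thesis by linarith
  qed
  obtain n where n: "real n > (B + a) / a" using reals_Archimedean2 by blast
  have "n > 0"
  proof (rule ccontr)
    assume "\<not> n > 0"
    then have "B + a < 0" using n a by (simp add: divide_less_0_iff)
    with bound[of 1] a show False by simp
  qed
  have "a * real n > B + a" using n a by (simp add: field_simps)
  then have "real n * (B - a * (real n - 1)) < 0" using \<open>n > 0\<close> by (intro mult_pos_neg) (auto simp: algebra_simps)
  then show False using bound[of n] by (simp add: algebra_simps)
qed

lemma gram_diff_nonneg:
  fixes A B D :: real
  assumes "B\<^sup>2 \<le> A * D" "0 \<le> A" "0 \<le> D"
  shows "0 \<le> A - 2 * B + D"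
proof -
  have "B \<le> sqrt A * sqrt D" using assms by (metis real_le_rsqrt real_sqrt_mult)
  moreover have "0 \<le> (sqrt A - sqrt D)\<^sup>2" by simp
  then have "2 * (sqrt A * sqrt D) \<le> A + D" using assms by (simp add: power2_diff)
  ultimately show ?thesis by linarith
qed

text \<open>Two pairs of vectors \<open>u, v\<close> and \<open>u', v'\<close> with Gram entries \<open>A, B, D\<close> and \<open>A', B', D'\<close>:
  this is the triangle inequality for
  \<open>u \<otimes> u' - v \<otimes> v' = u \<otimes> (u' - v') + (u - v) \<otimes> v'\<close>.\<close>

lemma gram_tensor_triangle:
  fixes A B D A' B' D' :: real
  assumes "B\<^sup>2 \<le> A * D" "B'\<^sup>2 \<le> A' * D'" and nonneg: "0 \<le> A" "0 \<le> D" "0 \<le> A'" "0 \<le> D'"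
  shows "sqrt (A * A' - 2 * (B * B') + D * D')
    \<le> sqrt A * sqrt (A' - 2 * B' + D') + sqrt (A - 2 * B + D) * sqrt D'"
proof -
  note e = gram_diff_nonneg
  let ?e = "A - 2 * B + D" and ?e' = "A' - 2 * B' + D'"
  \<comment> \<open>Cauchy-Schwarz for u and u - v: the right side minus the left side is A D -
    B^2.\<close>
  have "(A - B)\<^sup>2 \<le> A * ?e" using assms(1) by (simp add: power2_eq_square algebra_simps)
  then have 1: "\<bar>A - B\<bar> \<le> sqrt A * sqrt ?e" by (metis real_sqrt_le_mono real_sqrt_abs real_sqrt_mult)
  have "(D' - B')\<^sup>2 \<le> D' * ?e'" using assms(2) by (simp add: power2_eq_square algebra_simps)
  then have 2: "\<bar>D' - B'\<bar> \<le> sqrt D' * sqrt ?e'" by (metis real_sqrt_le_mono real_sqrt_abs real_sqrt_mult)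
  \<comment> \<open>Half of the cross term in the squared norm of the sum: the inner product of u
    \<otimes> (u' - v') and (u - v) \<otimes> v'.\<close>
  have "- ((A - B) * (D' - B')) \<le> \<bar>A - B\<bar> * \<bar>D' - B'\<bar>" by (metis abs_mult abs_ge_minus_self)
  also have "\<dots> \<le> (sqrt A * sqrt ?e) * (sqrt D' * sqrt ?e')"
    using 1 2 nonneg e[OF assms(1)] by (intro mult_mono) auto
  finally have "A * A' - 2 * (B * B') + D * D'
      \<le> A * ?e' + ?e * D' + 2 * ((sqrt A * sqrt ?e) * (sqrt D' * sqrt ?e'))"
    by (simp add: algebra_simps)
  also have "\<dots> = (sqrt A * sqrt ?e' + sqrt ?e * sqrt D')\<^sup>2"
    using nonneg e[OF assms(1)] e[OF assms(2)]
    by (simp add: power2_sum power_mult_distrib mult_ac)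
  finally show ?thesis
    using nonneg e[OF assms(1)] e[OF assms(2)] by (intro real_le_lsqrt) auto
qed

text \<open>\<open>W * E\<close> bounds the error of one factor. In the telescoping each \<mu>
  factor has norm at most 1 and each Q factor norm at most W, and W \<ge> 1 brings all terms to the
  same power of W.\<close>

lemma gram_prod_bound:
  fixes A B D :: "'i \<Rightarrow> real"
  assumes "finite S" and W: "W \<ge> 1" and E: "E \<ge> 0"
    and cs: "\<And>i. (B i)\<^sup>2 \<le> A i * D i" and A: "\<And>i. 0 \<le> A i" "\<And>i. A i \<le> 1"
    and D: "\<And>i. 0 \<le> D i" "\<And>i. D i \<le> W\<^sup>2"
    and err: "\<And>i. A i - 2 * B i + D i \<le> (W * E)\<^sup>2"
  shows "sqrt (prod A S - 2 * prod B S + prod D S) \<le> real (card S) * W ^ card S * E"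
  using assms(1)
proof (induction S rule: finite_induct)
  case (insert i S)
  have cs_S: "(prod B S)\<^sup>2 \<le> prod A S * prod D S"
    unfolding prod_power_distrib prod.distrib[symmetric] by (intro prod_mono) (auto simp: cs)
  have D_S: "prod D S \<le> (W ^ card S)\<^sup>2"
  proof -
    have "prod D S \<le> (\<Prod>i\<in>S. W\<^sup>2)" by (intro prod_mono) (auto simp: D)
    then show ?thesis by (simp add: power_mult[symmetric] mult.commute)
  qed
  have A_S: "0 \<le> prod A S" and D_S0: "0 \<le> prod D S" using A D by (auto intro: prod_nonneg)
  have "sqrt (prod A (insert i S) - 2 * prod B (insert i S) + prod D (insert i S))
      \<le> sqrt (A i) * sqrt (prod A S - 2 * prod B S + prod D S) + sqrt (A i - 2 * B i + D i) * sqrt (prod D S)"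
    unfolding prod.insert[OF insert(1,2)]
    by (rule gram_tensor_triangle[OF cs cs_S A(1) D(1) A_S D_S0])
  also have "\<dots> \<le> 1 * (real (card S) * W ^ card S * E) + (W * E) * W ^ card S"
  proof (intro add_mono mult_mono)
    show "sqrt (A i - 2 * B i + D i) \<le> W * E" using err W E by (intro real_le_lsqrt) auto
    show "sqrt (prod D S) \<le> W ^ card S" using D_S W by (intro real_le_lsqrt) auto
    show "sqrt (A i) \<le> 1" using A by simp
    show "sqrt (prod A S - 2 * prod B S + prod D S) \<le> real (card S) * W ^ card S * E"
      by (rule insert.IH)
    show "0 \<le> sqrt (prod A S - 2 * prod B S + prod D S)"
      using gram_diff_nonneg[OF cs_S A_S D_S0] by simp
    show "0 \<le> W * E" using W E by simp
    show "0 \<le> sqrt (prod D S)" using D_S0 by simp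
  qed simp
  also have "\<dots> \<le> real (card S) * (W * W ^ card S) * E + (W * E) * W ^ card S"
  proof -
    have "1 * W ^ card S \<le> W * W ^ card S" using W by (intro mult_right_mono) auto
    then have "real (card S) * (W ^ card S) * E \<le> real (card S) * (W * W ^ card S) * E"
      using E by (intro mult_right_mono mult_left_mono) auto
    then show ?thesis by simp
  qed
  also have "\<dots> = real (card (insert i S)) * W ^ card (insert i S) * E"
    using insert(1,2) by (simp add: algebra_simps)
  finally show ?case .
qed auto

subsection \<open>Integration error in a reproducing kernel Hilbert space\<close>

context rkhs
begin

lemma sum_mem:
  assumes "finite S" "\<And>s. s \<in> S \<Longrightarrow> F s \<in> H"
  shows "(\<lambda>x. \<Sum>s\<in>S. F s x) \<in> H"
  using assms by (induction S rule: finite_induct) (auto intro: zero_mem add_mem)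

lemma ip_zero: "h \<in> H \<Longrightarrow> ip (\<lambda>x. 0) h = 0"
  using ip_scale[of "\<lambda>x. 0" h 0] zero_mem by simp

lemma ip_sum:
  assumes "finite S" "\<And>s. s \<in> S \<Longrightarrow> F s \<in> H" "h \<in> H"
  shows "ip (\<lambda>x. \<Sum>s\<in>S. F s x) h = (\<Sum>s\<in>S. ip (F s) h)"
  using assms
proof (induction S rule: finite_induct)
  case (insert s S)
  then show ?case using ip_add[of "F s" "\<lambda>x. \<Sum>s\<in>S. F s x" h] sum_mem[of S F] by simp
qed (simp add: ip_zero)

lemma diff_mem: "f \<in> H \<Longrightarrow> g \<in> H \<Longrightarrow> (\<lambda>x. f x - g x) \<in> H"
  using add_mem[of f "\<lambda>x. -1 * g x"] scale_mem[of g "-1"] by simp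

lemma ip_diff:
  assumes "f \<in> H" "g \<in> H" "h \<in> H"
  shows "ip (\<lambda>x. f x - g x) h = ip f h - ip g h"
  using ip_add[of f "\<lambda>x. -1 * g x" h] ip_scale[of g h "-1"] scale_mem[of g "-1"] assms by simp

lemma ip_diff_right:
  assumes "f \<in> H" "g \<in> H" "h \<in> H"
  shows "ip h (\<lambda>x. f x - g x) = ip h f - ip h g"
  using ip_diff[OF assms] ip_commute[OF assms(3) diff_mem[OF assms(1,2)]]
    ip_commute[OF assms(1,3)] ip_commute[OF assms(2,3)] by simp

lemma ip_sum_right:
  assumes "finite S" "\<And>s. s \<in> S \<Longrightarrow> F s \<in> H" "h \<in> H"
  shows "ip h (\<lambda>x. \<Sum>s\<in>S. F s x) = (\<Sum>s\<in>S. ip h (F s))"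
proof -
  have "ip h (\<lambda>x. \<Sum>s\<in>S. F s x) = ip (\<lambda>x. \<Sum>s\<in>S. F s x) h"
    by (intro ip_commute sum_mem assms)
  also have "\<dots> = (\<Sum>s\<in>S. ip (F s) h)" by (rule ip_sum[OF assms])
  also have "\<dots> = (\<Sum>s\<in>S. ip h (F s))" by (intro sum.cong refl ip_commute assms)
  finally show ?thesis .
qed

lemma ip_scale_right:
  assumes "f \<in> H" "h \<in> H"
  shows "ip h (\<lambda>x. c * f x) = c * ip h f"
  using ip_scale[OF assms] ip_commute[OF assms(2) scale_mem[OF assms(1)]] ip_commute[OF assms] by simp

lemma kernel_commute: "k x y = k y x"
  using reproducing[OF kernel_mem[of x], of y] reproducing[OF kernel_mem[of y], of x]
    ip_commute[OF kernel_mem[of x] kernel_mem[of y]] by simp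

text \<open>Expanding the norm of g - c f with c = \<open>ip f g\<close> avoids dividing by the norm
  of f, hence any case distinction.\<close>

lemma ip_sq_le:
  assumes "f \<in> H" "ip f f \<le> 1" "g \<in> H"
  shows "(ip f g)\<^sup>2 \<le> ip g g"
proof -
  define c where "c = ip f g"
  have cf: "(\<lambda>x. c * f x) \<in> H" using assms by (intro scale_mem)
  have "0 \<le> ip (\<lambda>x. g x - c * f x) (\<lambda>x. g x - c * f x)"
    by (intro ip_nonneg diff_mem assms cf)
  also have "\<dots> = ip g g - 2 * c * c + c * c * ip f f"
    using assms cf diff_mem[OF assms(3) cf] ip_commute[OF assms(1,3)]
    by (simp add: ip_diff ip_diff_right ip_scale ip_scale_right c_def)
  also have "\<dots> \<le> ip g g - 2 * c * c + c * c * 1"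
    using assms(2) by (intro add_left_mono mult_left_mono) auto
  finally show ?thesis by (simp add: c_def power2_eq_square)
qed

text \<open>\<open>P\<close> is positive semidefinite by \<open>ip_sq_le\<close>, applied to f and a
  sum of functions \<open>r (z i)\<close>. Since M is a probability measure, constants survive
  integration: the mean of \<open>e\<close> is the error of f, and the \<open>ip (r x) (r y)\<close>
  part of the double integral is the right-hand side.\<close>

lemma integral_error_sq_le:
  fixes c :: "'s \<Rightarrow> real" and p :: "'s \<Rightarrow> 'a"
  assumes "prob_space M" and f: "f \<in> H" "ip f f \<le> 1" and S: "finite S"
    and int_f: "integrable M f" and int_k: "\<And>x. integrable M (k x)"
    and int_diag: "integrable M (\<lambda>x. k x x)"
    and int_kk: "integrable M (\<lambda>x. \<integral>y. k x y \<partial>M)"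
    and "integrable M (\<lambda>x. f x * f x)"
  shows "((\<integral>x. f x \<partial>M) - (\<Sum>s\<in>S. c s * f (p s)))\<^sup>2
    \<le> (\<integral>x. \<integral>y. k x y \<partial>M \<partial>M) - 2 * (\<Sum>s\<in>S. c s * (\<integral>y. k (p s) y \<partial>M))
      + (\<Sum>s\<in>S. c s * (\<Sum>t\<in>S. c t * k (p s) (p t)))"
proof -
  interpret M: prob_space M by fact
  define r where "r x = (\<lambda>z. k z x - (\<Sum>s\<in>S. c s * k z (p s)))" for x
  define e where "e x = f x - (\<Sum>s\<in>S. c s * f (p s))" for x
  define P where "P x y = ip (r x) (r y) - e x * e y" for x y
  define q where "q x = (\<Sum>s\<in>S. c s * k (p s) x)" for x
  define qq where "qq = (\<Sum>s\<in>S. c s * (\<Sum>t\<in>S. c t * k (p s) (p t)))"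
  have r_mem: "r x \<in> H" for x
    unfolding r_def using S by (intro diff_mem kernel_mem sum_mem scale_mem)
  have ip_r: "ip g (r x) = g x - (\<Sum>s\<in>S. c s * g (p s))" if "g \<in> H" for g x
    unfolding r_def using that S
    by (simp add: ip_diff_right ip_sum_right ip_scale_right kernel_mem sum_mem scale_mem reproducing)
  have P_eq: "P x y = k x y - q x - q y + qq - e x * e y" for x y
    unfolding P_def ip_r[OF r_mem]
    by (simp add: r_def q_def qq_def kernel_commute[of y] kernel_commute[of y "p _"]
        right_diff_distrib sum_subtractf)
  have P_sym: "P x y = P y x" for x y
    unfolding P_def using ip_commute[OF r_mem r_mem, of x y] by simp
  have psd: "0 \<le> (\<Sum>i<n. \<Sum>j<n. P (z i) (z j))" for n and z :: "nat \<Rightarrow> 'a"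
  proof -
    define R where "R = (\<lambda>x. \<Sum>i<n. r (z i) x)"
    have R: "R \<in> H" unfolding R_def by (intro sum_mem r_mem) auto
    have "ip f R = (\<Sum>i<n. e (z i))"
      unfolding R_def using f by (simp add: ip_sum_right r_mem ip_r e_def)
    moreover have "ip R R = (\<Sum>i<n. \<Sum>j<n. ip (r (z i)) (r (z j)))"
    proof -
      have "ip R R = (\<Sum>i<n. ip (r (z i)) R)"
        by (subst (1) R_def) (intro ip_sum r_mem R finite_lessThan)
      also have "\<dots> = (\<Sum>i<n. \<Sum>j<n. ip (r (z i)) (r (z j)))"
        unfolding R_def by (intro sum.cong ip_sum_right r_mem finite_lessThan refl)
      finally show ?thesis .
    qed
    ultimately have "(\<Sum>i<n. \<Sum>j<n. P (z i) (z j)) = ip R R - (ip f R)\<^sup>2"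
      by (simp add: P_def sum_subtractf sum_product power2_eq_square)
    then show ?thesis using ip_sq_le[OF f R] by simp
  qed
  have int_q: "integrable M q"
    unfolding q_def by (intro Bochner_Integration.integrable_sum integrable_mult_right int_k)
  have int_e: "integrable M e"
    unfolding e_def by (intro Bochner_Integration.integrable_diff int_f) auto
  have int_ee: "integrable M (\<lambda>x. e x * e x)"
  proof -
    let ?Q = "\<Sum>s\<in>S. c s * f (p s)"
    have "e x * e x = f x * f x - (2 * ?Q) * f x + ?Q * ?Q" for x
      by (simp add: e_def algebra_simps)
    then show ?thesis using assms(9) int_f by simp
  qed
  have inner: "(\<integral>y. P x y \<partial>M) = (\<integral>y. k x y \<partial>M) - q x - (\<integral>y. q y \<partial>M) + qq - e x * (\<integral>y. e y \<partial>M)" for x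
    unfolding P_eq by (simp add: int_k int_q int_e M.prob_space)
  have "0 \<le> (\<integral>x. \<integral>y. P x y \<partial>M \<partial>M)"
  proof (rule M.psd_double_integral_nonneg)
    show "integrable M (P x)" for x unfolding P_eq[abs_def] by (simp add: int_k int_q int_e)
    show "integrable M (\<lambda>x. P x x)" unfolding P_eq by (simp add: int_diag int_q int_ee)
    show "integrable M (\<lambda>x. \<integral>y. P x y \<partial>M)" unfolding inner by (simp add: int_kk int_q int_e)
    show "P x y = P y x" for x y by (rule P_sym)
    show "0 \<le> (\<Sum>i<n. \<Sum>j<n. P (z i) (z j))" for n and z :: "nat \<Rightarrow> 'a" by (rule psd)
  qed
  also have "\<dots> = (\<integral>x. \<integral>y. k x y \<partial>M \<partial>M) - 2 * (\<integral>y. q y \<partial>M) + qq - (\<integral>y. e y \<partial>M)\<^sup>2"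
    unfolding inner by (simp add: int_kk int_q int_e M.prob_space power2_eq_square)
  also have "(\<integral>y. q y \<partial>M) = (\<Sum>s\<in>S. c s * (\<integral>y. k (p s) y \<partial>M))"
    unfolding q_def by (simp add: int_k)
  also have "(\<integral>y. e y \<partial>M) = (\<integral>x. f x \<partial>M) - (\<Sum>s\<in>S. c s * f (p s))"
    unfolding e_def by (simp add: int_f M.prob_space)
  finally show ?thesis by (simp add: qq_def)
qed

end

text \<open>f(y) - f(x) is the inner product of f with k(., y) - k(., x), whose squared norm is the
  expression in the continuity hypothesis. The lemma is there to make members of the unit ball
  measurable.\<close>

lemma rkhs_continuous_mem:
  fixes x :: "'a :: t2_space"
  assumes "rkhs k H ip" and f: "f \<in> H" "ip f f \<le> 1" and cont: "isCont (\<lambda>y. k y y - 2 * k y x + k x x) x"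
  shows "isCont f x"
proof -
  interpret rkhs k H ip by fact
  have bound: "norm (f y - f x) \<le> sqrt (k y y - 2 * k y x + k x x)" for y
  proof (rule real_le_rsqrt)
    have "(ip f (\<lambda>z. k z y - k z x))\<^sup>2 \<le> ip (\<lambda>z. k z y - k z x) (\<lambda>z. k z y - k z x)"
      by (intro ip_sq_le f diff_mem kernel_mem)
    then have "(f y - f x)\<^sup>2 \<le> k y y - 2 * k y x + k x x"
      using f(1) kernel_commute[of x y]
      by (simp add: ip_diff_right ip_diff kernel_mem diff_mem reproducing)
    then show "(norm (f y - f x))\<^sup>2 \<le> k y y - 2 * k y x + k x x" by simp
  qed
  have "((\<lambda>y. sqrt (k y y - 2 * k y x + k x x)) \<longlongrightarrow> 0) (at x)"
    using tendsto_real_sqrt[OF cont[unfolded isCont_def]] by simp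
  then have "((\<lambda>y. f y - f x) \<longlongrightarrow> 0) (at x)"
    by (rule Lim_null_comparison[rotated]) (intro always_eventually allI bound)
  then show ?thesis unfolding isCont_def by (simp add: LIM_zero_iff)
qed

section \<open>Integrals of coordinatewise products against the Gaussian measure\<close>

lemma prod_Basis_vec:
  fixes g :: "real ^ 'd::finite \<Rightarrow> 'b::comm_monoid_mult"
  shows "(\<Prod>b\<in>Basis. g b) = (\<Prod>i\<in>UNIV. g (axis i 1))"
proof -
  have *: "(Basis :: (real ^ 'd) set) = range (\<lambda>i. axis i 1)" by (auto simp: Basis_vec_def)
  show ?thesis
    unfolding * by (subst prod.reindex) (auto simp: inj_on_def axis_eq_axis)
qed

lemma borel_measurable_vec_nth_real [measurable]: "(\<lambda>x :: real ^ 'd::finite. x $ i) \<in> borel_measurable borel"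
  by (intro borel_measurable_continuous_onI continuous_intros)

lemma nn_integral_std_gaussian_prod:
  fixes h :: "'d::finite \<Rightarrow> real \<Rightarrow> real"
  assumes [measurable]: "\<And>i. h i \<in> borel_measurable borel" and h0: "\<And>i t. 0 \<le> h i t"
  shows "(\<integral>\<^sup>+x. ennreal (\<Prod>i\<in>UNIV. h i (x $ i)) \<partial>std_gaussian)
    = (\<Prod>i\<in>UNIV. \<integral>\<^sup>+t. ennreal (h i t) \<partial>std_normal_distribution)"
proof -
  \<comment> \<open>Lebesgue measure factorises over basis vectors, whereas \<open>h\<close> is
    indexed by coordinates; \<open>ix\<close> recovers the coordinate of a basis vector.\<close>
  define ix where "ix b = (SOME i :: 'd. b = axis i (1::real))" for b
  have ix: "ix (axis i 1) = i" for i unfolding ix_def by (rule some_equality) (auto simp: axis_eq_axis)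
  define F where "F b t = std_normal_density t * h (ix b) t" for b t
  have "(\<integral>\<^sup>+x. ennreal (\<Prod>i\<in>UNIV. h i (x $ i)) \<partial>std_gaussian)
      = (\<integral>\<^sup>+x. ennreal (\<Prod>i\<in>UNIV. std_normal_density (x $ i)) * ennreal (\<Prod>i\<in>UNIV. h i (x $ i)) \<partial>lborel)"
    unfolding std_gaussian_def by (subst nn_integral_density) auto
  also have "\<dots> = (\<integral>\<^sup>+x. (\<Prod>b\<in>Basis. ennreal (F b (x \<bullet> b))) \<partial>lborel)"
    by (simp add: prod_Basis_vec F_def ix inner_axis prod.distrib h0 prod_nonneg ennreal_mult' prod_ennreal)
  also have "\<dots> = (\<Prod>b\<in>Basis. \<integral>\<^sup>+t. ennreal (F b t) \<partial>lborel)"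
    by (rule nn_integral_lborel_prod) (auto simp: F_def h0)
  also have "\<dots> = (\<Prod>i\<in>UNIV. \<integral>\<^sup>+t. ennreal (h i t) \<partial>std_normal_distribution)"
    by (simp add: prod_Basis_vec F_def ix nn_integral_density ennreal_mult' h0)
  finally show ?thesis .
qed

lemma sets_std_gaussian [measurable_cong]: "sets std_gaussian = sets borel"
  by (simp add: std_gaussian_def)

lemma prob_space_std_gaussian: "prob_space (std_gaussian :: (real ^ 'd::finite) measure)"
proof
  interpret N: real_distribution std_normal_distribution by (rule real_dist_normal_dist)
  have "emeasure (std_gaussian :: (real ^ 'd) measure) (space std_gaussian) = (\<integral>\<^sup>+(x :: real ^ 'd). 1 \<partial>std_gaussian)"
    by simp
  also have "\<dots> = 1"
    using nn_integral_std_gaussian_prod[of "\<lambda>(i :: 'd) t. 1"] N.emeasure_space_1 by simp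
  finally show "emeasure (std_gaussian :: (real ^ 'd) measure) (space std_gaussian) = 1" .
qed

lemma integrable_std_gaussian_bounded:
  fixes f :: "real ^ 'd::finite \<Rightarrow> real"
  assumes "f \<in> borel_measurable borel" "\<And>x. \<bar>f x\<bar> \<le> B"
  shows "integrable std_gaussian f"
proof -
  interpret prob_space "std_gaussian :: (real ^ 'd) measure" by (rule prob_space_std_gaussian)
  show ?thesis using assms by (intro integrable_const_bound[of _ B]) auto
qed

lemma integral_std_gaussian_prod:
  fixes h :: "'d::finite \<Rightarrow> real \<Rightarrow> real"
  assumes [measurable]: "\<And>i. h i \<in> borel_measurable borel" and h: "\<And>i t. 0 \<le> h i t" "\<And>i t. h i t \<le> 1"
  shows "integrable std_gaussian (\<lambda>x. \<Prod>i\<in>UNIV. h i (x $ i))" (is ?A)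
    and "(\<integral>x. (\<Prod>i\<in>UNIV. h i (x $ i)) \<partial>std_gaussian) = (\<Prod>i\<in>UNIV. \<integral>t. h i t \<partial>std_normal_distribution)" (is ?B)
proof -
  interpret N: real_distribution std_normal_distribution by (rule real_dist_normal_dist)
  have "(\<Prod>i\<in>UNIV. h i (x $ i)) \<le> 1" "0 \<le> (\<Prod>i\<in>UNIV. h i (x $ i))" for x
    using h by (auto intro: prod_le_1 prod_nonneg)
  then show ?A by (intro integrable_std_gaussian_bounded[of _ 1]) auto
  have int: "integrable std_normal_distribution (h i)" for i
    using h by (intro N.integrable_const_bound[of _ 1]) auto
  have "ennreal (\<integral>x. (\<Prod>i\<in>UNIV. h i (x $ i)) \<partial>std_gaussian)
      = (\<integral>\<^sup>+x. ennreal (\<Prod>i\<in>UNIV. h i (x $ i)) \<partial>std_gaussian)"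
    by (rule nn_integral_eq_integral[symmetric]) (use \<open>?A\<close> h in \<open>auto intro: prod_nonneg\<close>)
  also have "\<dots> = (\<Prod>i\<in>UNIV. ennreal (\<integral>t. h i t \<partial>std_normal_distribution))"
    unfolding nn_integral_std_gaussian_prod[OF assms(1) h(1)]
    by (intro prod.cong nn_integral_eq_integral int refl) (use h in auto)
  also have "\<dots> = ennreal (\<Prod>i\<in>UNIV. \<integral>t. h i t \<partial>std_normal_distribution)"
    by (rule prod_ennreal) (use h in auto)
  finally show ?B
    by (subst (asm) ennreal_inj) (use h in \<open>auto intro!: prod_nonneg Bochner_Integration.integral_nonneg\<close>)
qed

subsection \<open>Tensor product rules\<close>

lemma gauss_kernel_bounds: "0 < gauss_kernel l x y" "gauss_kernel l x y \<le> 1" "gauss_kernel l x x = 1"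
proof -
  show "0 < gauss_kernel l x y"
    unfolding gauss_kernel_def by (intro prod_pos gauss_kernel1_bounds)
  show "gauss_kernel l x y \<le> 1"
    unfolding gauss_kernel_def by (intro prod_le_1 conjI less_imp_le[OF gauss_kernel1_bounds(1)] gauss_kernel1_bounds(2))
  show "gauss_kernel l x x = 1"
    by (simp add: gauss_kernel_def gauss_kernel1_bounds)
qed

lemma borel_measurable_gauss_kernel [measurable]: "gauss_kernel l x \<in> borel_measurable borel"
  unfolding gauss_kernel_def[abs_def] by measurable

lemma borel_measurable_mem_gauss_rkhs:
  assumes "rkhs (gauss_kernel l) H ip" "f \<in> H" "ip f f \<le> 1"
  shows "f \<in> borel_measurable borel"
proof (rule borel_measurable_continuous_onI, rule continuous_at_imp_continuous_on, rule ballI)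
  fix x
  have "continuous_on UNIV (\<lambda>y. gauss_kernel l y x)"
    unfolding gauss_kernel_def gauss_kernel1_def divide_inverse by (intro continuous_intros)
  then have "isCont (\<lambda>y. gauss_kernel l y x) x"
    by (simp add: continuous_on_eq_continuous_at)
  then have "isCont (\<lambda>y. gauss_kernel l y y - 2 * gauss_kernel l y x + gauss_kernel l x x) x"
    unfolding gauss_kernel_bounds(3) by (intro continuous_intros)
  then show "isCont f x" by (rule rkhs_continuous_mem[where k = "gauss_kernel l" and H = H and ip = ip, OF assms])
qed

lemma gauss_rkhs_mem_le_1:
  assumes "rkhs (gauss_kernel l) H ip" "f \<in> H" "ip f f \<le> 1"
  shows "\<bar>f x\<bar> \<le> 1"
proof -
  interpret rkhs "gauss_kernel l" H ip by fact
  have "(f x)\<^sup>2 \<le> gauss_kernel l x x"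
    using ip_sq_le[OF assms(2,3) kernel_mem[of x]] by (simp add: reproducing kernel_mem assms(2))
  then show ?thesis by (simp add: gauss_kernel_bounds abs_square_le_1)
qed

lemma gauss_kernel1_mean_bounds:
  "0 \<le> (\<integral>s. gauss_kernel1 l t s \<partial>std_normal_distribution)"
  "(\<integral>s. gauss_kernel1 l t s \<partial>std_normal_distribution) \<le> 1"
proof -
  interpret N: real_distribution std_normal_distribution by (rule real_dist_normal_dist)
  show "0 \<le> (\<integral>s. gauss_kernel1 l t s \<partial>std_normal_distribution)"
    by (intro Bochner_Integration.integral_nonneg) (simp add: gauss_kernel1_bounds less_imp_le)
  have "integrable std_normal_distribution (gauss_kernel1 l t)"
    by (intro N.integrable_const_bound[of _ 1]) (auto simp: gauss_kernel1_bounds less_imp_le)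
  then show "(\<integral>s. gauss_kernel1 l t s \<partial>std_normal_distribution) \<le> 1"
    by (intro N.integral_le_const) (auto simp: gauss_kernel1_bounds)
qed

lemma borel_measurable_gauss_kernel1_mean:
  "(\<lambda>t. \<integral>s. gauss_kernel1 l t s \<partial>std_normal_distribution) \<in> borel_measurable borel"
proof -
  interpret N: real_distribution std_normal_distribution by (rule real_dist_normal_dist)
  show ?thesis by measurable
qed

lemma gauss_kernel_mean:
  "(\<integral>y. gauss_kernel l x y \<partial>std_gaussian) = (\<Prod>i\<in>UNIV. \<integral>s. gauss_kernel1 (l i) (x $ i) s \<partial>std_normal_distribution)"
  unfolding gauss_kernel_def
  by (rule integral_std_gaussian_prod(2)[of "\<lambda>i. gauss_kernel1 (l i) (x $ i)"])
     (auto simp: gauss_kernel1_bounds less_imp_le)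

lemma gauss_tensor_rule_error:
  fixes l :: "'d::finite \<Rightarrow> real"
  assumes "rkhs (gauss_kernel l) H ip" "f \<in> H" "ip f f \<le> 1"
    and quad: "\<And>i. gauss_quadrature (l i) W (N i) (M i) (x i) (w i)" and W: "W \<ge> 1"
    and E: "\<And>i. 2 * mercer_const (l i) * mercer_rate (l i) ^ M i \<le> E"
  shows "\<bar>(\<integral>x. f x \<partial>std_gaussian) - tensor_rule N x w f\<bar> \<le> real CARD('d) * W ^ CARD('d) * E"
proof -
  interpret rkhs "gauss_kernel l" H ip by fact
  define A where "A i = gauss_quadrature.mu_mu (l i)" for i
  define B where "B i = gauss_quadrature.mu_Q (l i) (N i) (x i) (w i)" for i
  define D where "D i = gauss_quadrature.Q_Q (l i) (N i) (x i) (w i)" for i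
  define m where "m i t = (\<integral>s. gauss_kernel1 (l i) t s \<partial>std_normal_distribution)" for i t
  \<comment> \<open>Over the full index type the extensionality in \<open>PiE\<close> is vacuous, so
    these are exactly the multi-indices of the tensor rule. In this form \<open>prod_sum_PiE\<close>
    turns sums over multi-indices into products of one-dimensional sums.\<close>
  define S where "S = PiE UNIV (\<lambda>i. {1..N i})"
  define c where "c I = (\<Prod>i\<in>UNIV. w i (I i))" for I
  define p where "p I = (\<chi> i. x i (I i))" for I
  have m01: "0 \<le> m i t" "m i t \<le> 1" for i t
    unfolding m_def by (rule gauss_kernel1_mean_bounds)+
  have [measurable]: "m i \<in> borel_measurable borel" for i
    unfolding m_def by (rule borel_measurable_gauss_kernel1_mean)
  have S: "finite S" "{I. \<forall>i. 1 \<le> I i \<and> I i \<le> N i} = S"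
    by (auto simp: S_def intro!: finite_PiE)
  have A_eq: "A i = (\<integral>t. m i t \<partial>std_normal_distribution)" for i
    using gauss_quadrature.mu_mu_def[OF quad[of i]] by (simp add: A_def m_def)
  have B_eq: "B i = (\<Sum>n=1..N i. w i n * m i (x i n))" for i
    using gauss_quadrature.mu_Q_def[OF quad[of i]] by (simp add: B_def m_def)
  have D_eq: "D i = (\<Sum>n=1..N i. w i n * (\<Sum>n'=1..N i. w i n' * gauss_kernel1 (l i) (x i n) (x i n')))" for i
    using gauss_quadrature.Q_Q_def[OF quad[of i]] by (simp add: D_def)
  have mean: "(\<integral>y. gauss_kernel l z y \<partial>std_gaussian) = (\<Prod>i\<in>UNIV. m i (z $ i))" for z
    unfolding gauss_kernel_mean m_def ..
  have mean2: "integrable std_gaussian (\<lambda>z. \<Prod>i\<in>UNIV. m i (z $ i))"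
    "(\<integral>z. (\<Prod>i\<in>UNIV. m i (z $ i)) \<partial>std_gaussian) = prod A UNIV"
    unfolding A_eq
    by (intro integral_std_gaussian_prod m01; measurable)+
  have fm: "f \<in> borel_measurable borel" by (rule borel_measurable_mem_gauss_rkhs[where l = l and H = H and ip = ip and f = f, OF assms(1-3)])
  have f1: "\<bar>f z\<bar> \<le> 1" for z by (rule gauss_rkhs_mem_le_1[where l = l and H = H and ip = ip and f = f, OF assms(1-3)])
  have "((\<integral>x. f x \<partial>std_gaussian) - (\<Sum>I\<in>S. c I * f (p I)))\<^sup>2
    \<le> (\<integral>z. \<integral>y. gauss_kernel l z y \<partial>std_gaussian \<partial>std_gaussian)
      - 2 * (\<Sum>I\<in>S. c I * (\<integral>y. gauss_kernel l (p I) y \<partial>std_gaussian))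
      + (\<Sum>I\<in>S. c I * (\<Sum>J\<in>S. c J * gauss_kernel l (p I) (p J)))"
  proof (rule integral_error_sq_le[OF prob_space_std_gaussian assms(2,3) S(1)])
    show "integrable std_gaussian f" using fm f1 by (rule integrable_std_gaussian_bounded)
    show "integrable std_gaussian (gauss_kernel l z)" for z
      by (rule integrable_std_gaussian_bounded[of _ 1]) (auto simp: gauss_kernel_bounds less_imp_le)
    show "integrable std_gaussian (\<lambda>z. gauss_kernel l z z)"
      unfolding gauss_kernel_bounds(3) by (rule integrable_std_gaussian_bounded[of _ 1]) auto
    show "integrable std_gaussian (\<lambda>z. \<integral>y. gauss_kernel l z y \<partial>std_gaussian)"
      unfolding mean by (rule mean2(1))
    show "integrable std_gaussian (\<lambda>z. f z * f z)"
    proof (rule integrable_std_gaussian_bounded[of _ 1])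
      show "\<bar>f z * f z\<bar> \<le> 1" for z
        unfolding abs_mult by (rule mult_le_one) (auto simp: f1)
    qed (use fm in measurable)
  qed
  also have "(\<integral>z. \<integral>y. gauss_kernel l z y \<partial>std_gaussian \<partial>std_gaussian) = prod A UNIV"
    unfolding mean by (rule mean2(2))
  also have "(\<Sum>I\<in>S. c I * (\<integral>y. gauss_kernel l (p I) y \<partial>std_gaussian)) = prod B UNIV"
    unfolding B_eq mean c_def p_def S_def prod.distrib[symmetric]
    by (subst prod_sum_PiE) auto
  also have "(\<Sum>I\<in>S. c I * (\<Sum>J\<in>S. c J * gauss_kernel l (p I) (p J))) = prod D UNIV"
  proof -
    have "(\<Sum>J\<in>S. c J * gauss_kernel l (p I) (p J))
        = (\<Prod>i\<in>UNIV. \<Sum>n'=1..N i. w i n' * gauss_kernel1 (l i) (x i (I i)) (x i n'))" for I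
      unfolding gauss_kernel_def c_def p_def S_def prod.distrib[symmetric]
      by (subst prod_sum_PiE) auto
    then show ?thesis
      unfolding D_eq c_def S_def by (subst prod_sum_PiE) (auto simp: prod.distrib)
  qed
  also have "(\<Sum>I\<in>S. c I * f (p I)) = tensor_rule N x w f"
    unfolding tensor_rule_def S(2) c_def p_def ..
  finally have "\<bar>(\<integral>x. f x \<partial>std_gaussian) - tensor_rule N x w f\<bar>
      \<le> sqrt (prod A UNIV - 2 * prod B UNIV + prod D UNIV)"
    by (metis real_sqrt_abs real_sqrt_le_mono)
  also have "\<dots> \<le> real CARD('d) * W ^ CARD('d) * E"
  proof (rule gram_prod_bound)
    have e: "0 \<le> 2 * mercer_const (l i) * mercer_rate (l i) ^ M i" for i
      using mercer_const_ge_1[OF gauss_quadrature.l[OF quad[of i]]]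
        mercer_rate_bounds[OF gauss_quadrature.l[OF quad[of i]]] by simp
    show "0 \<le> E" using e E by (rule order_trans)
    show "A i - 2 * B i + D i \<le> (W * E)\<^sup>2" for i
    proof -
      have "(W * (2 * mercer_const (l i) * mercer_rate (l i) ^ M i))\<^sup>2 \<le> (W * E)\<^sup>2"
        by (rule power_mono[OF mult_left_mono[OF E] mult_nonneg_nonneg[OF _ e]]) (use W in auto)
      then show ?thesis
        using gauss_quadrature.gram_error[OF quad[of i]] by (simp add: A_def B_def D_def)
    qed
    show "(B i)\<^sup>2 \<le> A i * D i" for i
      unfolding A_def B_def D_def by (rule gauss_quadrature.gram_Cauchy_Schwarz[OF quad])
    show "0 \<le> A i" "A i \<le> 1" for i
      unfolding A_def by (rule gauss_quadrature.mu_mu_nonneg[OF quad] gauss_quadrature.mu_mu_le_1[OF quad])+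
    show "0 \<le> D i" "D i \<le> W\<^sup>2" for i
      unfolding D_def by (rule gauss_quadrature.Q_Q_nonneg[OF quad] gauss_quadrature.Q_Q_le[OF quad])+
  qed (use W in auto)
  finally show ?thesis .
qed

theorem theorem4p2:
  fixes l :: "'d::finite \<Rightarrow> real"
    and H :: "(real ^ 'd \<Rightarrow> real) set"
    and ip :: "(real ^ 'd \<Rightarrow> real) \<Rightarrow> (real ^ 'd \<Rightarrow> real) \<Rightarrow> real"
  assumes "\<And>i. l i > 0"
    and "rkhs (gauss_kernel l) H ip"
  shows "\<exists>C \<eta> :: real. C > 0 \<and> 0 < \<eta> \<and> \<eta> < 1 \<and>
    (\<forall>(N :: 'd \<Rightarrow> nat) (x :: 'd \<Rightarrow> nat \<Rightarrow> real) (w :: 'd \<Rightarrow> nat \<Rightarrow> real) (W :: real) (M :: 'd \<Rightarrow> nat).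
      W \<ge> 1 \<longrightarrow>
      (\<forall>i. (\<Sum>n=1..N i. \<bar>w i n\<bar>) \<le> W) \<longrightarrow>
      (\<forall>i. M i \<ge> 1) \<longrightarrow>
      (\<forall>i. \<forall>n<M i. quadrature (N i) (x i) (w i) (mercer_phi (l i) n)
          = (\<integral>t. mercer_phi (l i) n t \<partial>std_normal_distribution)) \<longrightarrow>
      (\<forall>i. \<forall>n\<in>{1..N i}. \<bar>x i n\<bar> \<le> 2 * sqrt (real (M i)) / mercer_beta (l i)) \<longrightarrow>
      worst_case_error H ip (tensor_rule N x w)
        \<le> ereal (C * W ^ CARD('d) * \<eta> ^ Min (range M))) \<and>
    (\<forall>\<beta> \<tau> lam :: real.
      (\<forall>i. mercer_beta (l i) = \<beta> \<and> mercer_tau (l i) = \<tau> \<and> mercer_lambda (l i) = lam) \<longrightarrow>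
      C = 2 * real CARD('d) *
            (1.087 * sqrt (\<tau> * \<beta>) / (1 - sqrt lam * exp (1 / \<beta>\<^sup>2))) ^ CARD('d) \<and>
      \<eta> = sqrt lam * exp (1 / \<beta>\<^sup>2))"
proof -
  \<comment> \<open>Maxima over the coordinates cover unequal length-scales, and collapse to the
    explicit formulas when the parameters agree.\<close>
  define K where "K = Max (range (\<lambda>i. mercer_const (l i)))"
  define \<eta> where "\<eta> = Max (range (\<lambda>i. mercer_rate (l i)))"
  define C where "C = 2 * real CARD('d) * K ^ CARD('d)"
  have K_ge: "mercer_const (l i) \<le> K" for i unfolding K_def by (rule Max_ge) auto
  have \<eta>_ge: "mercer_rate (l i) \<le> \<eta>" for i unfolding \<eta>_def by (rule Max_ge) auto
  have K1: "K \<ge> 1" using mercer_const_ge_1[OF assms(1)] K_ge order_trans by blast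
  have \<eta>: "0 < \<eta>" "\<eta> < 1"
  proof -
    show "0 < \<eta>" using mercer_rate_bounds(1)[OF assms(1)] \<eta>_ge less_le_trans by blast
    show "\<eta> < 1" unfolding \<eta>_def using mercer_rate_bounds(2)[OF assms(1)] by (subst Max_less_iff) auto
  qed
  have "C > 0" using K1 by (simp add: C_def)
  moreover have "worst_case_error H ip (tensor_rule N x w) \<le> ereal (C * W ^ CARD('d) * \<eta> ^ Min (range M))"
    if W: "W \<ge> 1" and weights: "\<forall>i. (\<Sum>n=1..N i. \<bar>w i n\<bar>) \<le> W" and M: "\<forall>i. M i \<ge> 1"
      and exact: "\<forall>i. \<forall>n<M i. quadrature (N i) (x i) (w i) (mercer_phi (l i) n)
          = (\<integral>t. mercer_phi (l i) n t \<partial>std_normal_distribution)"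
      and nodes: "\<forall>i. \<forall>n\<in>{1..N i}. \<bar>x i n\<bar> \<le> 2 * sqrt (real (M i)) / mercer_beta (l i)"
    for N :: "'d \<Rightarrow> nat" and x w :: "'d \<Rightarrow> nat \<Rightarrow> real" and W :: real and M :: "'d \<Rightarrow> nat"
  proof -
    define E where "E = 2 * K * \<eta> ^ Min (range M)"
    have quad: "gauss_quadrature (l i) W (N i) (M i) (x i) (w i)" for i
      by standard (use that assms(1) in auto)
    have E: "2 * mercer_const (l i) * mercer_rate (l i) ^ M i \<le> E" for i
    proof -
      have "mercer_rate (l i) ^ M i \<le> \<eta> ^ M i"
        using mercer_rate_bounds[OF assms(1)[of i]] \<eta>_ge by (intro power_mono) auto
      also have "\<dots> \<le> \<eta> ^ Min (range M)" using \<eta> by (intro power_decreasing) auto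
      finally show ?thesis
        unfolding E_def using K_ge[of i] K1 \<eta> mercer_const_ge_1[OF assms(1)[of i]] mercer_rate_bounds[OF assms(1)[of i]]
        by (intro mult_mono) auto
    qed
    show ?thesis
      unfolding worst_case_error_def
    proof (rule SUP_least)
      fix f assume "f \<in> {f \<in> H. sqrt (ip f f) \<le> 1}"
      then have f: "f \<in> H" "ip f f \<le> 1" by auto
      have "\<bar>(\<integral>x. f x \<partial>std_gaussian) - tensor_rule N x w f\<bar> \<le> real CARD('d) * W ^ CARD('d) * E"
        by (rule gauss_tensor_rule_error[where l = l and H = H and ip = ip and f = f, OF assms(2) f quad W E])
      also have "\<dots> = 2 * real CARD('d) * K ^ 1 * (W ^ CARD('d) * \<eta> ^ Min (range M))"
        by (simp add: E_def)
      \<comment> \<open>K \<ge> 1 and d \<ge> 1 raise the single factor K to the d-th power that C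
        contains.\<close>
      also have "\<dots> \<le> 2 * real CARD('d) * K ^ CARD('d) * (W ^ CARD('d) * \<eta> ^ Min (range M))"
        using K1 W \<eta> by (intro mult_right_mono mult_left_mono power_increasing) (auto simp: Suc_le_eq)
      finally show "ereal \<bar>(\<integral>x. f x \<partial>std_gaussian) - tensor_rule N x w f\<bar>
          \<le> ereal (C * W ^ CARD('d) * \<eta> ^ Min (range M))"
        by (simp add: C_def mult.assoc)
    qed
  qed
  moreover have "C = 2 * real CARD('d) * (1.087 * sqrt (\<tau> * \<beta>) / (1 - sqrt lam * exp (1 / \<beta>\<^sup>2))) ^ CARD('d)
      \<and> \<eta> = sqrt lam * exp (1 / \<beta>\<^sup>2)"
    if "\<forall>i. mercer_beta (l i) = \<beta> \<and> mercer_tau (l i) = \<tau> \<and> mercer_lambda (l i) = lam" for \<beta> \<tau> lam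
    using that by (simp add: C_def K_def \<eta>_def mercer_const_def mercer_rate_def)
  ultimately show ?thesis using \<eta> by blast
qed

end
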